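(* Let $R$ be a ring Morita equivalent to a commutative ring. (i) A finitely generated right $R$-module is dual Baer if and only if it is semisimple. (ii) If $R$ is semi-Artinian, then the dual Baer right $R$-modules are precisely the semisimple right $R$-modules.
   Context: Rings have a unit element and modules are right unitary modules. A right $R$-module $M$ with $S=\mathrm{End}_R(M)$ is dual Baer if for every submodule $N\leq M$ the right ideal $\mathrm{Hom}_R(M,N)$ of $S$ equals $eS$ for some $e=e^2\in S$. $R$ is semi-Artinian if every nonzero right $R$-module has nonzero socle. *)

theory Defs
  imports "HOL-Algebra.AbelCoset" "HOL-Library.Equipollence"
begin

section \<open>Right modules over a not necessarily commutative ring\<close>

text \<open>As in HOL-Algebra's own (commutative) modules, the additive group of a module is carried by
  a ring record whose multiplicative part is ignored.\<close>

record ('r, 'm) rmod = "'m ring" +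
  ract :: "'m \<Rightarrow> 'r \<Rightarrow> 'm" (infixl \<open>\<cdot>\<index>\<close> 70)

locale right_module = R?: ring R + M?: abelian_group M
  for R (structure) and M :: "('r, 'm, 'z) rmod_scheme" (structure) +
  assumes ract_closed:
      "\<lbrakk>x \<in> carrier M; a \<in> carrier R\<rbrakk> \<Longrightarrow> x \<cdot>\<^bsub>M\<^esub> a \<in> carrier M"
    and ract_add_ring:
      "\<lbrakk>x \<in> carrier M; a \<in> carrier R; b \<in> carrier R\<rbrakk>
        \<Longrightarrow> x \<cdot>\<^bsub>M\<^esub> (a \<oplus>\<^bsub>R\<^esub> b) = x \<cdot>\<^bsub>M\<^esub> a \<oplus>\<^bsub>M\<^esub> x \<cdot>\<^bsub>M\<^esub> b"
    and ract_add_module: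
      "\<lbrakk>x \<in> carrier M; y \<in> carrier M; a \<in> carrier R\<rbrakk>
        \<Longrightarrow> (x \<oplus>\<^bsub>M\<^esub> y) \<cdot>\<^bsub>M\<^esub> a = x \<cdot>\<^bsub>M\<^esub> a \<oplus>\<^bsub>M\<^esub> y \<cdot>\<^bsub>M\<^esub> a"
    and ract_mult:
      "\<lbrakk>x \<in> carrier M; a \<in> carrier R; b \<in> carrier R\<rbrakk>
        \<Longrightarrow> x \<cdot>\<^bsub>M\<^esub> (a \<otimes>\<^bsub>R\<^esub> b) = (x \<cdot>\<^bsub>M\<^esub> a) \<cdot>\<^bsub>M\<^esub> b"
    and ract_one:
      "x \<in> carrier M \<Longrightarrow> x \<cdot>\<^bsub>M\<^esub> \<one>\<^bsub>R\<^esub> = x"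

definition submodule_of :: "('r, 'x) ring_scheme \<Rightarrow> 'm set \<Rightarrow> ('r, 'm, 'z) rmod_scheme \<Rightarrow> bool" where
  "submodule_of R N M \<longleftrightarrow>
     additive_subgroup N M \<and> (\<forall>x\<in>N. \<forall>a\<in>carrier R. x \<cdot>\<^bsub>M\<^esub> a \<in> N)"

definition gen_submodule :: "('r, 'x) ring_scheme \<Rightarrow> ('r, 'm, 'z) rmod_scheme \<Rightarrow> 'm set \<Rightarrow> 'm set" where
  "gen_submodule R M X = \<Inter>{N. submodule_of R N M \<and> X \<subseteq> N}"

definition fin_gen :: "('r, 'x) ring_scheme \<Rightarrow> ('r, 'm, 'z) rmod_scheme \<Rightarrow> bool" where
  "fin_gen R M \<longleftrightarrow> (\<exists>X. finite X \<and> X \<subseteq> carrier M \<and> gen_submodule R M X = carrier M)"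

definition simple_mod :: "('r, 'x) ring_scheme \<Rightarrow> ('r, 'm, 'z) rmod_scheme \<Rightarrow> bool" where
  "simple_mod R M \<longleftrightarrow> right_module R M \<and> carrier M \<noteq> {\<zero>\<^bsub>M\<^esub>} \<and>
     (\<forall>N. submodule_of R N M \<longrightarrow> N = {\<zero>\<^bsub>M\<^esub>} \<or> N = carrier M)"

text \<open>The socle is the sum of all simple submodules; a sum of submodules is the submodule
  generated by their union.\<close>

definition socle :: "('r, 'x) ring_scheme \<Rightarrow> ('r, 'm, 'z) rmod_scheme \<Rightarrow> 'm set" where
  "socle R M =
     gen_submodule R M (\<Union>{N. submodule_of R N M \<and> simple_mod R (M\<lparr>carrier := N\<rparr>)})"

definition semisimple_mod :: "('r, 'x) ring_scheme \<Rightarrow> ('r, 'm, 'z) rmod_scheme \<Rightarrow> bool" where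
  "semisimple_mod R M \<longleftrightarrow> right_module R M \<and> socle R M = carrier M"

text \<open>A definition cannot quantify over types, so the modules considered are those with carrier in a
  type \<open>'u\<close>. If \<open>carrier R\<close> embeds into \<open>'u\<close>, this comprises all cyclic modules up to isomorphism,
  and the notion does not depend on \<open>'u\<close>.\<close>

definition semi_artinian :: "'u itself \<Rightarrow> ('r, 'x) ring_scheme \<Rightarrow> bool" where
  "semi_artinian U R \<longleftrightarrow>
     (\<forall>M :: ('r, 'u) rmod. right_module R M \<and> carrier M \<noteq> {\<zero>\<^bsub>M\<^esub>} \<longrightarrow> socle R M \<noteq> {\<zero>\<^bsub>M\<^esub>})"


section \<open>Homomorphisms and dual Baer modules\<close>

text \<open>Homomorphisms are extensional, so that they are equal as soon as they agree on the carrier.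
  Consequently the homomorphisms from \<open>M\<close> to a submodule \<open>N\<close> of \<open>M\<close> are elements of the endomorphism
  ring of \<open>M\<close>, with no inclusion map to be inserted.\<close>

definition mod_hom ::
    "('r, 'x) ring_scheme \<Rightarrow> ('r, 'm, 'z) rmod_scheme \<Rightarrow> ('r, 'n, 'w) rmod_scheme \<Rightarrow> ('m \<Rightarrow> 'n) set" where
  "mod_hom R M N = {f \<in> carrier M \<rightarrow>\<^sub>E carrier N.
     (\<forall>x\<in>carrier M. \<forall>y\<in>carrier M. f (x \<oplus>\<^bsub>M\<^esub> y) = f x \<oplus>\<^bsub>N\<^esub> f y) \<and>
     (\<forall>x\<in>carrier M. \<forall>a\<in>carrier R. f (x \<cdot>\<^bsub>M\<^esub> a) = f x \<cdot>\<^bsub>N\<^esub> a)}"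

definition end_ring :: "('r, 'x) ring_scheme \<Rightarrow> ('r, 'm, 'z) rmod_scheme \<Rightarrow> ('m \<Rightarrow> 'm) ring" where
  "end_ring R M =
     \<lparr>carrier = mod_hom R M M,
      mult = (\<lambda>g f. compose (carrier M) g f),
      one = (\<lambda>x\<in>carrier M. x),
      zero = (\<lambda>x\<in>carrier M. \<zero>\<^bsub>M\<^esub>),
      add = (\<lambda>f g. \<lambda>x\<in>carrier M. f x \<oplus>\<^bsub>M\<^esub> g x)\<rparr>"

definition dual_baer :: "('r, 'x) ring_scheme \<Rightarrow> ('r, 'm, 'z) rmod_scheme \<Rightarrow> bool" where
  "dual_baer R M \<longleftrightarrow> right_module R M \<and>
     (\<forall>N. submodule_of R N M \<longrightarrow>
        (\<exists>e\<in>carrier (end_ring R M). e \<otimes>\<^bsub>end_ring R M\<^esub> e = e \<and>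
           mod_hom R M (M\<lparr>carrier := N\<rparr>) = e <#\<^bsub>end_ring R M\<^esub> carrier (end_ring R M)))"


section \<open>Equivalence of categories and Morita equivalence\<close>

text \<open>\<open>Comp C A B D g f\<close> is the composite of \<open>f \<in> Hom C A B\<close> and \<open>g \<in> Hom C B D\<close>. Hom-sets of
  different pairs of objects may overlap; this is why composition, and the morphism part of a functor
  below, take the objects as arguments.\<close>

record ('o, 'h) cat =
  Obj :: "'o set"
  Hom :: "'o \<Rightarrow> 'o \<Rightarrow> 'h set"
  Comp :: "'o \<Rightarrow> 'o \<Rightarrow> 'o \<Rightarrow> 'h \<Rightarrow> 'h \<Rightarrow> 'h"
  Ident :: "'o \<Rightarrow> 'h"

definition is_category :: "('o, 'h) cat \<Rightarrow> bool" where
  "is_category C \<longleftrightarrow>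
     (\<forall>A\<in>Obj C. Ident C A \<in> Hom C A A) \<and>
     (\<forall>A\<in>Obj C. \<forall>B\<in>Obj C. \<forall>f\<in>Hom C A B.
        Comp C A A B f (Ident C A) = f \<and> Comp C A B B (Ident C B) f = f) \<and>
     (\<forall>A\<in>Obj C. \<forall>B\<in>Obj C. \<forall>D\<in>Obj C. \<forall>f\<in>Hom C A B. \<forall>g\<in>Hom C B D.
        Comp C A B D g f \<in> Hom C A D) \<and>
     (\<forall>A\<in>Obj C. \<forall>B\<in>Obj C. \<forall>D\<in>Obj C. \<forall>E\<in>Obj C.
        \<forall>f\<in>Hom C A B. \<forall>g\<in>Hom C B D. \<forall>h\<in>Hom C D E.
        Comp C A B E (Comp C B D E h g) f = Comp C A D E h (Comp C A B D g f))"

definition iso_in :: "('o, 'h) cat \<Rightarrow> 'o \<Rightarrow> 'o \<Rightarrow> 'h \<Rightarrow> bool" where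
  "iso_in C A B f \<longleftrightarrow> f \<in> Hom C A B \<and>
     (\<exists>g\<in>Hom C B A. Comp C A B A g f = Ident C A \<and> Comp C B A B f g = Ident C B)"

definition is_functor ::
    "('o, 'h) cat \<Rightarrow> ('p, 'k) cat \<Rightarrow> ('o \<Rightarrow> 'p) \<Rightarrow> ('o \<Rightarrow> 'o \<Rightarrow> 'h \<Rightarrow> 'k) \<Rightarrow> bool" where
  "is_functor C D Fo Fm \<longleftrightarrow>
     (\<forall>A\<in>Obj C. Fo A \<in> Obj D) \<and>
     (\<forall>A\<in>Obj C. \<forall>B\<in>Obj C. \<forall>f\<in>Hom C A B. Fm A B f \<in> Hom D (Fo A) (Fo B)) \<and>
     (\<forall>A\<in>Obj C. Fm A A (Ident C A) = Ident D (Fo A)) \<and>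
     (\<forall>A\<in>Obj C. \<forall>B\<in>Obj C. \<forall>E\<in>Obj C. \<forall>f\<in>Hom C A B. \<forall>g\<in>Hom C B E.
        Fm A E (Comp C A B E g f) = Comp D (Fo A) (Fo B) (Fo E) (Fm B E g) (Fm A B f))"

text \<open>\<open>nat_iso C D Fo Fm Go Gm \<eta>\<close>: \<open>\<eta>\<close> is a natural isomorphism from the functor \<open>F\<close> to the
  functor \<open>G\<close>, both from \<open>C\<close> to \<open>D\<close>.\<close>

definition nat_iso ::
    "('o, 'h) cat \<Rightarrow> ('p, 'k) cat \<Rightarrow> ('o \<Rightarrow> 'p) \<Rightarrow> ('o \<Rightarrow> 'o \<Rightarrow> 'h \<Rightarrow> 'k)
      \<Rightarrow> ('o \<Rightarrow> 'p) \<Rightarrow> ('o \<Rightarrow> 'o \<Rightarrow> 'h \<Rightarrow> 'k) \<Rightarrow> ('o \<Rightarrow> 'k) \<Rightarrow> bool" where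
  "nat_iso C D Fo Fm Go Gm \<eta> \<longleftrightarrow>
     (\<forall>A\<in>Obj C. iso_in D (Fo A) (Go A) (\<eta> A)) \<and>
     (\<forall>A\<in>Obj C. \<forall>B\<in>Obj C. \<forall>f\<in>Hom C A B.
        Comp D (Fo A) (Fo B) (Go B) (\<eta> B) (Fm A B f) =
        Comp D (Fo A) (Go A) (Go B) (Gm A B f) (\<eta> A))"

definition equivalent_categories :: "('o, 'h) cat \<Rightarrow> ('p, 'k) cat \<Rightarrow> bool" where
  "equivalent_categories C D \<longleftrightarrow>
     (\<exists>Fo Fm Go Gm \<eta> \<epsilon>.
        is_functor C D Fo Fm \<and> is_functor D C Go Gm \<and>
        nat_iso C C (\<lambda>A. A) (\<lambda>A B f. f) (\<lambda>A. Go (Fo A)) (\<lambda>A B f. Gm (Fo A) (Fo B) (Fm A B f)) \<eta> \<and>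
        nat_iso D D (\<lambda>A. Fo (Go A)) (\<lambda>A B f. Fm (Go A) (Go B) (Gm A B f)) (\<lambda>A. A) (\<lambda>A B f. f) \<epsilon>)"

definition mod_cat :: "('r, 'x) ring_scheme \<Rightarrow> (('r, 'u) rmod, 'u \<Rightarrow> 'u) cat" where
  "mod_cat R =
     \<lparr>Obj = {M. right_module R M},
      Hom = mod_hom R,
      Comp = (\<lambda>A B D g f. compose (carrier A) g f),
      Ident = (\<lambda>A. \<lambda>x\<in>carrier A. x)\<rparr>"

text \<open>Morita equivalence is equivalence of the categories of right modules, here of those modules with
  carrier in the type \<open>'u\<close>. An equivalence between the categories of all modules restricts to one
  between the modules of cardinality at most that of \<open>'u\<close>, provided \<open>'u\<close> is infinite and both rings
  embed into it. Conversely, under the same proviso, an equivalence between these small modules sends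
  the regular module to a progenerator with the expected endomorphism ring. Hence for such \<open>'u\<close> the
  notion is the usual one and does not depend on \<open>'u\<close>.\<close>

definition morita_equivalent ::
    "'u itself \<Rightarrow> ('r, 'x) ring_scheme \<Rightarrow> ('t, 'y) ring_scheme \<Rightarrow> bool" where
  "morita_equivalent U R T \<longleftrightarrow>
     equivalent_categories (mod_cat R :: (('r, 'u) rmod, 'u \<Rightarrow> 'u) cat)
                           (mod_cat T :: (('t, 'u) rmod, 'u \<Rightarrow> 'u) cat)"


section \<open>Well-definedness\<close>

lemma mod_hom_closed: "\<lbrakk>f \<in> mod_hom R A B; x \<in> carrier A\<rbrakk> \<Longrightarrow> f x \<in> carrier B"
  unfolding mod_hom_def by (auto intro: PiE_mem)

lemma mod_hom_eqI:
  "\<lbrakk>f \<in> mod_hom R A B; g \<in> mod_hom R A B; \<And>x. x \<in> carrier A \<Longrightarrow> f x = g x\<rbrakk> \<Longrightarrow> f = g"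
  unfolding mod_hom_def by (auto intro: PiE_ext)

lemma mod_hom_add:
  "\<lbrakk>f \<in> mod_hom R A B; x \<in> carrier A; y \<in> carrier A\<rbrakk> \<Longrightarrow> f (x \<oplus>\<^bsub>A\<^esub> y) = f x \<oplus>\<^bsub>B\<^esub> f y"
  unfolding mod_hom_def by blast

lemma mod_hom_act:
  "\<lbrakk>f \<in> mod_hom R A B; x \<in> carrier A; a \<in> carrier R\<rbrakk> \<Longrightarrow> f (x \<cdot>\<^bsub>A\<^esub> a) = f x \<cdot>\<^bsub>B\<^esub> a"
  unfolding mod_hom_def by blast

lemma (in right_module) restrict_in_mod_hom:
  assumes "\<And>x. x \<in> carrier M \<Longrightarrow> f x \<in> carrier B"
    and "\<And>x y. \<lbrakk>x \<in> carrier M; y \<in> carrier M\<rbrakk> \<Longrightarrow> f (x \<oplus>\<^bsub>M\<^esub> y) = f x \<oplus>\<^bsub>B\<^esub> f y"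
    and "\<And>x a. \<lbrakk>x \<in> carrier M; a \<in> carrier R\<rbrakk> \<Longrightarrow> f (x \<cdot>\<^bsub>M\<^esub> a) = f x \<cdot>\<^bsub>B\<^esub> a"
  shows "(\<lambda>x\<in>carrier M. f x) \<in> mod_hom R M B"
  using assms unfolding mod_hom_def by (auto simp: ract_closed)

lemma mod_cat_is_category:
  fixes R :: "('a, 'x) ring_scheme"
  shows "is_category (mod_cat R :: (('a, 'c) rmod, 'c \<Rightarrow> 'c) cat)"
proof -
  have comp: "compose (carrier A) g f \<in> mod_hom R A D"
    if A: "right_module R A" and f: "f \<in> mod_hom R A B" and g: "g \<in> mod_hom R B D"
    for A B D :: "('a, 'c) rmod" and f g
    unfolding compose_def
    by (rule right_module.restrict_in_mod_hom[OF A])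
       (simp_all add: mod_hom_closed[OF f] mod_hom_closed[OF g] mod_hom_add[OF f] mod_hom_add[OF g]
          mod_hom_act[OF f] mod_hom_act[OF g])
  have ident: "(\<lambda>x\<in>carrier A. x) \<in> mod_hom R A A"
    if A: "right_module R A" for A :: "('a, 'c) rmod"
    by (rule right_module.restrict_in_mod_hom[OF A]) simp_all
  have "compose (carrier A) f (\<lambda>x\<in>carrier A. x) = f"
    and "compose (carrier A) (\<lambda>x\<in>carrier B. x) f = f"
    if A: "right_module R A" and B: "right_module R B" and f: "f \<in> mod_hom R A B"
    for A B :: "('a, 'c) rmod" and f
     apply (rule mod_hom_eqI[OF comp[OF A ident[OF A] f] f], simp add: compose_eq)
    apply (rule mod_hom_eqI[OF comp[OF A f ident[OF B]] f], simp add: compose_eq mod_hom_closed[OF f])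
    done
  moreover have "compose (carrier A) (compose (carrier B) h g) f =
      compose (carrier A) h (compose (carrier A) g f)"
    if A: "right_module R A" and B: "right_module R B"
      and f: "f \<in> mod_hom R A B" and g: "g \<in> mod_hom R B D" and h: "h \<in> mod_hom R D E"
    for A B D E :: "('a, 'c) rmod" and f g h
    by (rule mod_hom_eqI[OF comp[OF A f comp[OF B g h]] comp[OF A comp[OF A f g] h]])
       (simp add: compose_eq mod_hom_closed[OF f])
  ultimately show ?thesis
    unfolding is_category_def mod_cat_def by (simp add: comp ident)
qed

lemma (in right_module) submodule_is_module:
  assumes "submodule_of R N M"
  shows "right_module R (M\<lparr>carrier := N\<rparr>)"
proof -
  interpret N: additive_subgroup N M using assms by (simp add: submodule_of_def)
  have sub: "x \<in> carrier M" if "x \<in> N" for x using that N.a_subset by blast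
  have neg: "\<exists>y\<in>N. x \<oplus>\<^bsub>M\<^esub> y = \<zero>\<^bsub>M\<^esub>" if "x \<in> N" for x
    using that sub N.a_inv_closed M.r_neg by blast
  have "abelian_group (M\<lparr>carrier := N\<rparr>)"
    by (intro abelian_groupI) (simp_all add: sub neg M.a_ac)
  moreover have "x \<cdot>\<^bsub>M\<^esub> a \<in> N" if "x \<in> N" "a \<in> carrier R" for x a
    using assms that by (simp add: submodule_of_def)
  ultimately show ?thesis
    by (intro right_module.intro right_module_axioms.intro R.ring_axioms)
       (simp_all add: sub ract_add_ring ract_add_module ract_mult ract_one)
qed

lemma (in right_module) end_ring_is_ring: "ring (end_ring R M)"
proof -
  have zero_act: "\<zero>\<^bsub>M\<^esub> \<cdot>\<^bsub>M\<^esub> a = \<zero>\<^bsub>M\<^esub>" if a: "a \<in> carrier R" for a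
    using ract_add_module[OF M.zero_closed M.zero_closed a] ract_closed[OF M.zero_closed a]
    by (metis M.add.l_cancel_one' M.l_zero M.zero_closed)
  have neg_act: "(\<ominus>\<^bsub>M\<^esub> x) \<cdot>\<^bsub>M\<^esub> a = \<ominus>\<^bsub>M\<^esub> (x \<cdot>\<^bsub>M\<^esub> a)"
    if "a \<in> carrier R" "x \<in> carrier M" for a x
    using that ract_add_module[of "\<ominus>\<^bsub>M\<^esub> x" x a] zero_act
    by (simp add: M.l_neg M.minus_equality ract_closed)
  let ?H = "mod_hom R M M"
  note H = mod_hom_closed[of _ R M M] mod_hom_add[of _ R M M] mod_hom_act[of _ R M M]
  have neg: "(\<lambda>x\<in>carrier M. \<ominus>\<^bsub>M\<^esub> f x) \<in> ?H" if "f \<in> ?H" for f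
    by (rule restrict_in_mod_hom) (simp_all add: H[OF that] neg_act M.minus_add)
  have add: "(\<lambda>x\<in>carrier M. f x \<oplus>\<^bsub>M\<^esub> g x) \<in> ?H" if f: "f \<in> ?H" and g: "g \<in> ?H" for f g
    by (rule restrict_in_mod_hom) (simp_all add: H[OF f] H[OF g] ract_add_module ract_closed M.a_ac)
  have zero: "(\<lambda>x\<in>carrier M. \<zero>\<^bsub>M\<^esub>) \<in> ?H"
    by (rule restrict_in_mod_hom) (simp_all add: zero_act)
  have one: "(\<lambda>x\<in>carrier M. x) \<in> ?H"
    by (rule restrict_in_mod_hom) simp_all
  have comp: "compose (carrier M) g f \<in> ?H" if f: "f \<in> ?H" and g: "g \<in> ?H" for f g
    unfolding compose_def by (rule restrict_in_mod_hom) (simp_all add: H[OF f] H[OF g])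
  let ?S = "end_ring R M"
  have S: "carrier ?S = ?H"
    "\<And>f g. f \<in> ?H \<Longrightarrow> g \<in> ?H \<Longrightarrow> f \<oplus>\<^bsub>?S\<^esub> g \<in> ?H"
    "\<And>f g. f \<in> ?H \<Longrightarrow> g \<in> ?H \<Longrightarrow> f \<otimes>\<^bsub>?S\<^esub> g \<in> ?H"
    "\<zero>\<^bsub>?S\<^esub> \<in> ?H" "\<one>\<^bsub>?S\<^esub> \<in> ?H"
    using add comp zero one by (simp_all add: end_ring_def)
  have ev: "(f \<oplus>\<^bsub>?S\<^esub> g) x = f x \<oplus>\<^bsub>M\<^esub> g x" "(f \<otimes>\<^bsub>?S\<^esub> g) x = f (g x)"
    "\<zero>\<^bsub>?S\<^esub> x = \<zero>\<^bsub>M\<^esub>" "\<one>\<^bsub>?S\<^esub> x = x" if "x \<in> carrier M" for f g x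
    using that by (simp_all add: end_ring_def compose_eq)
  have inverse: "\<exists>g\<in>?H. g \<oplus>\<^bsub>?S\<^esub> f = \<zero>\<^bsub>?S\<^esub>" if f: "f \<in> ?H" for f
    by (intro bexI[where x = "\<lambda>x\<in>carrier M. \<ominus>\<^bsub>M\<^esub> f x"] mod_hom_eqI[OF S(2)[OF neg[OF f] f] S(4)] neg[OF f])
       (simp add: ev H[OF f] M.l_neg)
  have eqI: "f = g" if "f \<in> ?H" "g \<in> ?H" "\<And>x. x \<in> carrier M \<Longrightarrow> f x = g x" for f g
    using that by (rule mod_hom_eqI)
  show ?thesis
    by (intro ringI abelian_groupI monoidI; (simp only: S inverse)?;
        (rule eqI; simp add: S ev H M.a_ac)?)
qed

end

theory Submission
  imports Defs
begin

text \<open>Every \<open>t \<in> T\<close> acts on \<open>Fo A\<close> by a \<open>T\<close>-endomorphism, hence by a natural endomorphism \<open>zeta t A\<close>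
  on every right \<open>R\<close>-module \<open>A\<close>, where \<open>Fo\<close> is the object part of an equivalence. Let \<open>M\<close> be dual Baer
  and \<open>V\<close> simple, and let \<open>I\<close> be the set of all \<open>t\<close> acting as zero on \<open>V\<close>. The submodule \<open>M I\<close> generated by
  the images of the endomorphisms \<open>zeta t M\<close> with \<open>t \<in> I\<close> is a direct summand of \<open>M\<close>, and \<open>I\<close> acts as
  zero on its complement, which is therefore semisimple. So \<open>M = M I + soc M\<close> for every simple \<open>V\<close>.

  If \<open>M\<close> is finitely generated and not semisimple, then \<open>soc M\<close> lies in a maximal submodule \<open>L\<close>, and
  \<open>V = M / L\<close> gives the contradiction \<open>M I + soc M \<subseteq> L\<close>. If \<open>R\<close> is semi-Artinian and
  \<open>M' = M / soc M\<close> is not zero, let \<open>A\<close> be the annihilator of \<open>M'\<close> in \<open>T\<close>. A simple submodule of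
  \<open>T / A\<close> provides \<open>s \<notin> A\<close> and a simple \<open>V\<close> with \<open>s I \<subseteq> A\<close>, whence \<open>M' s = M' I s = 0\<close>, a
  contradiction.\<close>

section \<open>Submodules and homomorphisms\<close>

context right_module
begin

section \<open>Arithmetic of the action, submodules and the socle\<close>

lemma zero_ract: "a \<in> carrier R \<Longrightarrow> \<zero>\<^bsub>M\<^esub> \<cdot>\<^bsub>M\<^esub> a = \<zero>\<^bsub>M\<^esub>"
  using ract_add_module[of "\<zero>\<^bsub>M\<^esub>" "\<zero>\<^bsub>M\<^esub>" a] ract_closed[of "\<zero>\<^bsub>M\<^esub>" a]
  by (metis M.add.l_cancel_one' M.l_zero M.zero_closed)

lemma ract_zero: "x \<in> carrier M \<Longrightarrow> x \<cdot>\<^bsub>M\<^esub> \<zero>\<^bsub>R\<^esub> = \<zero>\<^bsub>M\<^esub>"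
  using ract_add_ring[of x "\<zero>\<^bsub>R\<^esub>" "\<zero>\<^bsub>R\<^esub>"] ract_closed[of x "\<zero>\<^bsub>R\<^esub>"]
  by (metis M.add.l_cancel_one' R.l_zero R.zero_closed)

lemma ract_minus_one: "x \<in> carrier M \<Longrightarrow> x \<cdot>\<^bsub>M\<^esub> (\<ominus>\<^bsub>R\<^esub> \<one>\<^bsub>R\<^esub>) = \<ominus>\<^bsub>M\<^esub> x"
  using ract_add_ring[of x "\<ominus>\<^bsub>R\<^esub> \<one>\<^bsub>R\<^esub>" "\<one>\<^bsub>R\<^esub>"]
  by (simp add: R.l_neg ract_zero ract_one ract_closed M.minus_equality)

text \<open>Closure under negation follows from closure under the action, because the ring element
  -1 acts as negation.\<close>

lemma submodule_ofI:
  assumes "N \<subseteq> carrier M" "\<zero>\<^bsub>M\<^esub> \<in> N"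
    and "\<And>x y. \<lbrakk>x \<in> N; y \<in> N\<rbrakk> \<Longrightarrow> x \<oplus>\<^bsub>M\<^esub> y \<in> N"
    and act: "\<And>x a. \<lbrakk>x \<in> N; a \<in> carrier R\<rbrakk> \<Longrightarrow> x \<cdot>\<^bsub>M\<^esub> a \<in> N"
  shows "submodule_of R N M"
proof -
  have "\<ominus>\<^bsub>M\<^esub> x \<in> N" if "x \<in> N" for x
    using act[OF that, of "\<ominus>\<^bsub>R\<^esub> \<one>\<^bsub>R\<^esub>"] ract_minus_one[of x] that assms(1) by auto
  then have "subgroup N (add_monoid M)"
    using assms by (intro subgroup.intro) (auto simp flip: a_inv_def)
  then show ?thesis
    using act by (simp add: submodule_of_def additive_subgroup_def)
qed

lemma submodule_ofD:
  assumes "submodule_of R N M"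
  shows "\<And>x. x \<in> N \<Longrightarrow> x \<in> carrier M" "\<zero>\<^bsub>M\<^esub> \<in> N"
    and "\<And>x y. \<lbrakk>x \<in> N; y \<in> N\<rbrakk> \<Longrightarrow> x \<oplus>\<^bsub>M\<^esub> y \<in> N"
    and "\<And>x a. \<lbrakk>x \<in> N; a \<in> carrier R\<rbrakk> \<Longrightarrow> x \<cdot>\<^bsub>M\<^esub> a \<in> N"
    and "\<And>x. x \<in> N \<Longrightarrow> \<ominus>\<^bsub>M\<^esub> x \<in> N"
proof -
  interpret N: additive_subgroup N M using assms by (simp add: submodule_of_def)
  show "\<And>x. x \<in> N \<Longrightarrow> x \<in> carrier M" using N.a_subset by blast
  then show "\<And>x. x \<in> N \<Longrightarrow> \<ominus>\<^bsub>M\<^esub> x \<in> N" using N.a_inv_closed by simp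
  show "\<And>x a. \<lbrakk>x \<in> N; a \<in> carrier R\<rbrakk> \<Longrightarrow> x \<cdot>\<^bsub>M\<^esub> a \<in> N"
    using assms by (simp add: submodule_of_def)
qed (use assms in \<open>auto simp: submodule_of_def additive_subgroup.zero_closed additive_subgroup.a_closed\<close>)

lemma submodule_subset: "submodule_of R N M \<Longrightarrow> N \<subseteq> carrier M"
  using submodule_ofD(1) by blast

lemma carrier_submodule: "submodule_of R (carrier M) M"
  by (rule submodule_ofI) (auto simp: ract_closed)

lemma zero_submodule: "submodule_of R {\<zero>\<^bsub>M\<^esub>} M"
  by (rule submodule_ofI) (auto simp: zero_ract)

lemma submodule_Inter:
  assumes "\<N> \<noteq> {}" "\<And>N. N \<in> \<N> \<Longrightarrow> submodule_of R N M"
  shows "submodule_of R (\<Inter>\<N>) M"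
proof (rule submodule_ofI)
  show "\<Inter>\<N> \<subseteq> carrier M"
    using assms submodule_ofD(1) by blast
qed (use submodule_ofD[OF assms(2)] in auto)

lemma submodule_Int:
  "\<lbrakk>submodule_of R N M; submodule_of R P M\<rbrakk> \<Longrightarrow> submodule_of R (N \<inter> P) M"
  using submodule_Inter[of "{N, P}"] by auto

lemma submodule_sum:
  assumes "submodule_of R N M" "submodule_of R P M"
  shows "submodule_of R {n \<oplus>\<^bsub>M\<^esub> p | n p. n \<in> N \<and> p \<in> P} M"
proof (rule submodule_ofI)
  note N = submodule_ofD[OF assms(1)] and P = submodule_ofD[OF assms(2)]
  show "\<zero>\<^bsub>M\<^esub> \<in> {n \<oplus>\<^bsub>M\<^esub> p | n p. n \<in> N \<and> p \<in> P}"
    using N(2) P(2) M.l_zero[OF M.zero_closed] by (auto intro!: exI)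
  fix x y assume "x \<in> {n \<oplus>\<^bsub>M\<^esub> p | n p. n \<in> N \<and> p \<in> P}" "y \<in> {n \<oplus>\<^bsub>M\<^esub> p | n p. n \<in> N \<and> p \<in> P}"
  then obtain n p n' p' where *: "n \<in> N" "p \<in> P" "n' \<in> N" "p' \<in> P"
    and "x = n \<oplus>\<^bsub>M\<^esub> p" "y = n' \<oplus>\<^bsub>M\<^esub> p'" by blast
  then have "x \<oplus>\<^bsub>M\<^esub> y = (n \<oplus>\<^bsub>M\<^esub> n') \<oplus>\<^bsub>M\<^esub> (p \<oplus>\<^bsub>M\<^esub> p')"
    by (simp add: N(1) P(1) M.a_ac)
  then show "x \<oplus>\<^bsub>M\<^esub> y \<in> {n \<oplus>\<^bsub>M\<^esub> p | n p. n \<in> N \<and> p \<in> P}"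
    using * N(3) P(3) by blast
next
  note N = submodule_ofD[OF assms(1)] and P = submodule_ofD[OF assms(2)]
  fix x a assume "x \<in> {n \<oplus>\<^bsub>M\<^esub> p | n p. n \<in> N \<and> p \<in> P}" and a: "a \<in> carrier R"
  then obtain n p where *: "n \<in> N" "p \<in> P" and "x = n \<oplus>\<^bsub>M\<^esub> p" by blast
  then have "x \<cdot>\<^bsub>M\<^esub> a = n \<cdot>\<^bsub>M\<^esub> a \<oplus>\<^bsub>M\<^esub> p \<cdot>\<^bsub>M\<^esub> a"
    using a by (simp add: N(1) P(1) ract_add_module)
  then show "x \<cdot>\<^bsub>M\<^esub> a \<in> {n \<oplus>\<^bsub>M\<^esub> p | n p. n \<in> N \<and> p \<in> P}"
    using * N(4) P(4) a by blast
qed (use submodule_ofD(1)[OF assms(1)] submodule_ofD(1)[OF assms(2)] in auto)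

text \<open>Prepares the two applications of Zorn's lemma. Any two elements of the union lie in a
  common member, since members of a chain are comparable.\<close>

lemma submodule_Union_chain:
  assumes "\<C> \<noteq> {}" "subset.chain {N. submodule_of R N M} \<C>"
  shows "submodule_of R (\<Union>\<C>) M"
proof -
  have sub: "submodule_of R N M" if "N \<in> \<C>" for N
    using assms(2) that by (auto simp: subset.chain_def)
  show ?thesis
  proof (rule submodule_ofI)
    fix x y assume "x \<in> \<Union>\<C>" "y \<in> \<Union>\<C>"
    then obtain N P where NP: "N \<in> \<C>" "P \<in> \<C>" "x \<in> N" "y \<in> P" by blast
    then have "N \<subseteq> P \<or> P \<subseteq> N"
      using assms(2) unfolding subset_chain_def by blast
    then show "x \<oplus>\<^bsub>M\<^esub> y \<in> \<Union>\<C>"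
      using NP submodule_ofD(3)[OF sub] by blast
  next
    fix x a assume "x \<in> \<Union>\<C>" "a \<in> carrier R"
    then show "x \<cdot>\<^bsub>M\<^esub> a \<in> \<Union>\<C>"
      using submodule_ofD(4)[OF sub] by blast
  qed (use assms(1) submodule_ofD(1,2)[OF sub] in auto)
qed

lemma cyclic_submodule:
  assumes x: "x \<in> carrier M"
  shows "submodule_of R ((\<lambda>a. x \<cdot>\<^bsub>M\<^esub> a) ` carrier R) M"
proof (rule submodule_ofI)
  show "\<zero>\<^bsub>M\<^esub> \<in> (\<lambda>a. x \<cdot>\<^bsub>M\<^esub> a) ` carrier R"
    using ract_zero[OF x] by (metis R.zero_closed image_eqI)
next
  fix y a assume "y \<in> (\<lambda>a. x \<cdot>\<^bsub>M\<^esub> a) ` carrier R" and a: "a \<in> carrier R"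
  then obtain b where "b \<in> carrier R" "y = x \<cdot>\<^bsub>M\<^esub> b" by blast
  then show "y \<cdot>\<^bsub>M\<^esub> a \<in> (\<lambda>a. x \<cdot>\<^bsub>M\<^esub> a) ` carrier R"
    using a x by (auto simp flip: ract_mult)
qed (use x in \<open>auto simp: ract_closed simp flip: ract_add_ring\<close>)

lemma gen_submodule_submodule:
  "X \<subseteq> carrier M \<Longrightarrow> submodule_of R (gen_submodule R M X) M"
  unfolding gen_submodule_def using carrier_submodule by (intro submodule_Inter) auto

lemma gen_submodule_superset: "X \<subseteq> gen_submodule R M X"
  unfolding gen_submodule_def by blast

lemma gen_submodule_least: "\<lbrakk>submodule_of R N M; X \<subseteq> N\<rbrakk> \<Longrightarrow> gen_submodule R M X \<subseteq> N"
  unfolding gen_submodule_def by blast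

lemma socle_submodule: "submodule_of R (socle R M) M"
  unfolding socle_def by (rule gen_submodule_submodule) (auto dest: submodule_subset)

lemma submodule_restrict:
  assumes "submodule_of R N M" "submodule_of R P M" "N \<subseteq> P"
  shows "submodule_of R N (M\<lparr>carrier := P\<rparr>)"
proof -
  interpret P: right_module R "M\<lparr>carrier := P\<rparr>"
    by (rule submodule_is_module) fact
  show ?thesis
    using submodule_ofD[OF assms(1)] assms(3) by (intro P.submodule_ofI) auto
qed

section \<open>Homomorphisms, kernels, images and quotients\<close>

lemma inclusion_hom:
  assumes "submodule_of R N M"
  shows "(\<lambda>x\<in>N. x) \<in> mod_hom R (M\<lparr>carrier := N\<rparr>) M"
  using submodule_ofD[OF assms] by (auto simp: mod_hom_def)

lemma ident_hom: "(\<lambda>x\<in>carrier M. x) \<in> mod_hom R M M"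
  by (rule restrict_in_mod_hom) auto

lemma zero_hom:
  assumes "right_module R B"
  shows "(\<lambda>x\<in>carrier M. \<zero>\<^bsub>B\<^esub>) \<in> mod_hom R M B"
proof -
  interpret B: right_module R B by fact
  show ?thesis by (rule restrict_in_mod_hom) (auto simp: B.zero_ract)
qed

lemma compose_hom:
  assumes "f \<in> mod_hom R M B" "g \<in> mod_hom R B D"
  shows "compose (carrier M) g f \<in> mod_hom R M D"
  unfolding compose_def
  by (rule restrict_in_mod_hom)
     (simp_all add: mod_hom_closed[OF assms(1)] mod_hom_closed[OF assms(2)] mod_hom_add[OF assms(1)]
        mod_hom_add[OF assms(2)] mod_hom_act[OF assms(1)] mod_hom_act[OF assms(2)])

lemma hom_zero:
  assumes f: "f \<in> mod_hom R M B" and B: "right_module R B"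
  shows "f \<zero>\<^bsub>M\<^esub> = \<zero>\<^bsub>B\<^esub>"
proof -
  interpret B: right_module R B by fact
  \<comment> \<open>A homomorphism is only required to respect addition and the action; zero is
    therefore written as the multiple of itself by the scalar zero.\<close>
  have "f \<zero>\<^bsub>M\<^esub> = f (\<zero>\<^bsub>M\<^esub> \<cdot>\<^bsub>M\<^esub> \<zero>\<^bsub>R\<^esub>)" by (simp add: ract_zero)
  also have "\<dots> = \<zero>\<^bsub>B\<^esub>"
    using mod_hom_closed[OF f] by (simp add: mod_hom_act[OF f] B.ract_zero)
  finally show ?thesis .
qed

lemma hom_neg:
  assumes f: "f \<in> mod_hom R M B" and B: "right_module R B" and x: "x \<in> carrier M"
  shows "f (\<ominus>\<^bsub>M\<^esub> x) = \<ominus>\<^bsub>B\<^esub> f x"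
proof -
  interpret B: right_module R B by fact
  show ?thesis
    using x mod_hom_closed[OF f] mod_hom_act[OF f x, of "\<ominus>\<^bsub>R\<^esub> \<one>\<^bsub>R\<^esub>"]
    by (simp add: ract_minus_one B.ract_minus_one)
qed

lemma preimage_submodule:
  assumes f: "f \<in> mod_hom R M B" and B: "right_module R B" and N: "submodule_of R N B"
  shows "submodule_of R {x \<in> carrier M. f x \<in> N} M"
proof -
  interpret B: right_module R B by fact
  show ?thesis
    using B.submodule_ofD[OF N] mod_hom_add[OF f] mod_hom_act[OF f] hom_zero[OF f B]
    by (intro submodule_ofI) (auto simp: ract_closed)
qed

lemma image_submodule:
  assumes f: "f \<in> mod_hom R M B" and B: "right_module R B"
  shows "submodule_of R (f ` carrier M) B"
proof -
  interpret B: right_module R B by fact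
  show ?thesis
  proof (rule B.submodule_ofI)
    show "\<zero>\<^bsub>B\<^esub> \<in> f ` carrier M"
      using hom_zero[OF f B] by (metis M.zero_closed image_eqI)
  qed (auto simp: mod_hom_closed[OF f] ract_closed simp flip: mod_hom_add[OF f] mod_hom_act[OF f])
qed

lemma kernel_submodule:
  assumes "f \<in> mod_hom R M B" "right_module R B"
  shows "submodule_of R {x \<in> carrier M. f x = \<zero>\<^bsub>B\<^esub>} M"
  using preimage_submodule[OF assms right_module.zero_submodule[OF assms(2)]] by simp

text \<open>Extensionality depends on the domain alone, and a submodule keeps the operations of
  \<open>B\<close>, so the very same function changes its codomain, here and in the next
  lemma.\<close>

lemma mod_hom_restrict_codomain:
  "\<lbrakk>f \<in> mod_hom R M B; \<And>x. x \<in> carrier M \<Longrightarrow> f x \<in> N\<rbrakk>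
    \<Longrightarrow> f \<in> mod_hom R M (B\<lparr>carrier := N\<rparr>)"
  unfolding mod_hom_def by (auto simp: PiE_iff)

lemma mod_hom_enlarge_codomain:
  "\<lbrakk>f \<in> mod_hom R M (B\<lparr>carrier := N\<rparr>); N \<subseteq> carrier B\<rbrakk> \<Longrightarrow> f \<in> mod_hom R M B"
  unfolding mod_hom_def by (auto simp: PiE_iff)

text \<open>The quotient is carried by representatives of the cosets, because the cosets themselves would
  not have the type \<open>'u\<close>.\<close>

lemma quotient_exists:
  assumes N: "submodule_of R N M" and card: "carrier M \<lesssim> (UNIV :: 'u set)"
  obtains Q :: "('r, 'u) rmod" and q where "right_module R Q" "q \<in> mod_hom R M Q"
    "q ` carrier M = carrier Q" "{x \<in> carrier M. q x = \<zero>\<^bsub>Q\<^esub>} = N"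
proof -
  note N' = submodule_ofD[OF N]
  obtain j :: "_ \<Rightarrow> 'u" where j: "inj_on j (carrier M)"
    using card by (auto simp: lepoll_def)
  define c where "c x = {y \<in> carrier M. x \<ominus>\<^bsub>M\<^esub> y \<in> N}" for x
  have refl: "x \<ominus>\<^bsub>M\<^esub> x \<in> N" if "x \<in> carrier M" for x
    using that N'(2) by (simp add: M.r_neg a_minus_def)
  have sym: "y \<ominus>\<^bsub>M\<^esub> x \<in> N" if "x \<ominus>\<^bsub>M\<^esub> y \<in> N" "x \<in> carrier M" "y \<in> carrier M" for x y
    using N'(5)[OF that(1)] that(2,3) by (simp add: a_minus_def M.minus_add M.a_comm)
  have trans: "x \<ominus>\<^bsub>M\<^esub> z \<in> N"
    if "x \<ominus>\<^bsub>M\<^esub> y \<in> N" "y \<ominus>\<^bsub>M\<^esub> z \<in> N" "x \<in> carrier M" "y \<in> carrier M" "z \<in> carrier M" for x y z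
  proof -
    have "(x \<ominus>\<^bsub>M\<^esub> y) \<oplus>\<^bsub>M\<^esub> (y \<ominus>\<^bsub>M\<^esub> z) = x \<ominus>\<^bsub>M\<^esub> z"
      using that(3-5) by (simp add: a_minus_def M.a_assoc M.r_neg1)
    then show ?thesis using N'(3)[OF that(1,2)] by simp
  qed
  have c: "c x = c y \<longleftrightarrow> x \<ominus>\<^bsub>M\<^esub> y \<in> N" if x: "x \<in> carrier M" and y: "y \<in> carrier M" for x y
    using refl[OF y] sym trans x y unfolding c_def by blast
  \<comment> \<open>A coset \<open>c x\<close> is coded by the image under \<open>j\<close> of one
    chosen representative, so that the codes have type \<open>'u\<close>.\<close>
  define q where "q = (\<lambda>x\<in>carrier M. j (SOME y. y \<in> c x))"
  have q: "q x = q y \<longleftrightarrow> x \<ominus>\<^bsub>M\<^esub> y \<in> N" if x: "x \<in> carrier M" and y: "y \<in> carrier M" for x y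
  proof -
    have some: "(SOME y. y \<in> c x) \<in> c x" if "x \<in> carrier M" for x
      by (rule someI[of _ x]) (use that refl in \<open>simp add: c_def\<close>)
    have "c x = c y" if "z \<in> c x" "z \<in> c y" for z
      using that c[OF x, of z] c[OF y, of z] by (auto simp: c_def)
    moreover have "q x = q y \<Longrightarrow> (SOME z. z \<in> c x) = (SOME z. z \<in> c y)"
      using some[OF x] some[OF y] x y inj_onD[OF j, of "SOME z. z \<in> c x" "SOME z. z \<in> c y"]
      by (auto simp: q_def c_def)
    moreover have "c x = c y \<Longrightarrow> q x = q y"
      using x y by (simp add: q_def)
    ultimately have "q x = q y \<longleftrightarrow> c x = c y"
      using some[OF x] some[OF y] by metis
    then show ?thesis by (simp add: c[OF x y])
  qed
  have q_ext: "q \<in> extensional (carrier M)" by (simp add: q_def)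
  \<comment> \<open>A section of \<open>q\<close>: it lifts codes back to \<open>M\<close>, where
    the operations of the quotient are computed.\<close>
  define i where "i = inv_into (carrier M) q"
  have i: "i u \<in> carrier M" "q (i u) = u" if "u \<in> q ` carrier M" for u
    using that by (simp_all add: i_def inv_into_into f_inv_into_f)
  define Q :: "('r, 'u) rmod" where
    "Q = \<lparr>carrier = q ` carrier M, mult = undefined, one = undefined, zero = q \<zero>\<^bsub>M\<^esub>,
      add = (\<lambda>u v. q (i u \<oplus>\<^bsub>M\<^esub> i v)), ract = (\<lambda>u a. q (i u \<cdot>\<^bsub>M\<^esub> a))\<rparr>"
  \<comment> \<open>Lifting \<open>q x\<close> changes \<open>x\<close> only by an element of
    \<open>N\<close>; this makes the operations of \<open>Q\<close> independent of the lift.\<close>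
  have iq: "i (q x) \<ominus>\<^bsub>M\<^esub> x \<in> N" "i (q x) \<in> carrier M" if "x \<in> carrier M" for x
    using that i[of "q x"] q[of "i (q x)" x] by auto
  have add: "q x \<oplus>\<^bsub>Q\<^esub> q y = q (x \<oplus>\<^bsub>M\<^esub> y)" if x: "x \<in> carrier M" and y: "y \<in> carrier M" for x y
  proof -
    have "(i (q x) \<oplus>\<^bsub>M\<^esub> i (q y)) \<ominus>\<^bsub>M\<^esub> (x \<oplus>\<^bsub>M\<^esub> y) = (i (q x) \<ominus>\<^bsub>M\<^esub> x) \<oplus>\<^bsub>M\<^esub> (i (q y) \<ominus>\<^bsub>M\<^esub> y)"
      using x y iq(2) by (simp add: a_minus_def M.minus_add M.a_ac)
    also have "\<dots> \<in> N" by (rule N'(3)[OF iq(1)[OF x] iq(1)[OF y]])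
    finally show ?thesis
      using x y iq(2) by (simp add: Q_def q)
  qed
  have act: "q x \<cdot>\<^bsub>Q\<^esub> a = q (x \<cdot>\<^bsub>M\<^esub> a)" if x: "x \<in> carrier M" and a: "a \<in> carrier R" for x a
  proof -
    have "(\<ominus>\<^bsub>M\<^esub> x) \<cdot>\<^bsub>M\<^esub> a = \<ominus>\<^bsub>M\<^esub> (x \<cdot>\<^bsub>M\<^esub> a)"
      using x a ract_add_module[of "\<ominus>\<^bsub>M\<^esub> x" x a]
      by (simp add: M.l_neg zero_ract M.minus_equality ract_closed)
    then have "(i (q x) \<cdot>\<^bsub>M\<^esub> a) \<ominus>\<^bsub>M\<^esub> (x \<cdot>\<^bsub>M\<^esub> a) = (i (q x) \<ominus>\<^bsub>M\<^esub> x) \<cdot>\<^bsub>M\<^esub> a"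
      using x a iq(2) by (simp add: a_minus_def ract_add_module)
    also have "\<dots> \<in> N" by (rule N'(4)[OF iq(1)[OF x] a])
    finally show ?thesis
      using x a iq(2) by (simp add: Q_def q ract_closed)
  qed
  have carr: "carrier Q = q ` carrier M" and zero: "\<zero>\<^bsub>Q\<^esub> = q \<zero>\<^bsub>M\<^esub>"
    by (simp_all add: Q_def)
  have "abelian_group Q"
  proof (rule abelian_groupI)
    show "\<exists>y\<in>carrier Q. y \<oplus>\<^bsub>Q\<^esub> x = \<zero>\<^bsub>Q\<^esub>" if "x \<in> carrier Q" for x
      using that by (auto simp: carr zero add M.l_neg intro!: bexI[where x = "\<ominus>\<^bsub>M\<^esub> _"])
  qed (auto simp: carr zero add M.a_ac)
  then have "right_module R Q"
    by (intro right_module.intro right_module_axioms.intro R.ring_axioms)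
       (auto simp: carr add act ract_closed ract_add_ring ract_add_module ract_mult ract_one)
  moreover have "q \<in> mod_hom R M Q"
    using q_ext by (auto simp: mod_hom_def carr add act PiE_iff)
  moreover have "{x \<in> carrier M. q x = \<zero>\<^bsub>Q\<^esub>} = N"
  proof -
    have "x \<ominus>\<^bsub>M\<^esub> \<zero>\<^bsub>M\<^esub> = x" if "x \<in> carrier M" for x
      using that M.add.inv_one by (simp add: a_minus_def a_inv_def)
    then show ?thesis using N'(1) by (auto simp: zero q)
  qed
  ultimately show ?thesis using that carr by blast
qed

end

section \<open>Semisimple and dual Baer modules\<close>

context right_module
begin

text \<open>A submodule of the image pulls back to zero or to all of \<open>V\<close>, so the image
  is zero or simple. The form suits the equivalence, which controls homomorphisms out of
  \<open>V\<close> rather than simple submodules.\<close>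

lemma simple_image_subset_socle:
  assumes V: "simple_mod R V" and h: "h \<in> mod_hom R V M"
  shows "h ` carrier V \<subseteq> socle R M"
proof -
  interpret V: right_module R V using V by (simp add: simple_mod_def)
  define N where "N = h ` carrier V"
  have N: "submodule_of R N M"
    unfolding N_def by (rule V.image_submodule[OF h right_module_axioms])
  show ?thesis
  proof (cases "N = {\<zero>\<^bsub>M\<^esub>}")
    case True
    then show ?thesis using submodule_ofD(2)[OF socle_submodule] by (simp add: N_def)
  next
    case False
    have MN: "right_module R (M\<lparr>carrier := N\<rparr>)" by (rule submodule_is_module[OF N])
    have hN: "h \<in> mod_hom R V (M\<lparr>carrier := N\<rparr>)"
      by (rule V.mod_hom_restrict_codomain[OF h]) (simp add: N_def)
    have "P = {\<zero>\<^bsub>M\<^esub>} \<or> P = N" if P: "submodule_of R P (M\<lparr>carrier := N\<rparr>)" for P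
    proof -
      have PN: "P \<subseteq> N" "\<zero>\<^bsub>M\<^esub> \<in> P"
        using right_module.submodule_ofD(1,2)[OF MN P] by auto
      have "h \<zero>\<^bsub>V\<^esub> = \<zero>\<^bsub>M\<^esub>" by (rule V.hom_zero[OF h right_module_axioms])
      moreover consider "{v \<in> carrier V. h v \<in> P} = {\<zero>\<^bsub>V\<^esub>}" | "{v \<in> carrier V. h v \<in> P} = carrier V"
        using V V.preimage_submodule[OF hN MN P] unfolding simple_mod_def by blast
      ultimately show ?thesis
        using PN by cases (auto simp: N_def)
    qed
    then have "simple_mod R (M\<lparr>carrier := N\<rparr>)"
      using MN False by (simp add: simple_mod_def)
    with N have "N \<subseteq> \<Union>{N. submodule_of R N M \<and> simple_mod R (M\<lparr>carrier := N\<rparr>)}" by blast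
    also have "\<dots> \<subseteq> socle R M"
      unfolding socle_def by (rule gen_submodule_superset)
    finally show ?thesis by (simp add: N_def)
  qed
qed

lemma socle_least:
  assumes "submodule_of R L M"
    and "\<And>N. \<lbrakk>submodule_of R N M; simple_mod R (M\<lparr>carrier := N\<rparr>)\<rbrakk> \<Longrightarrow> N \<subseteq> L"
  shows "socle R M \<subseteq> L"
  unfolding socle_def using assms by (intro gen_submodule_least) auto

text \<open>By Zorn's lemma take \<open>P\<close> maximal among the submodules meeting
  \<open>N\<close> trivially. A simple submodule outside \<open>N + P\<close> could be added to
  \<open>P\<close> without spoiling this, so \<open>N + P\<close> contains every simple submodule
  and hence the socle.\<close>

lemma semisimple_complement:
  assumes ss: "socle R M = carrier M" and N: "submodule_of R N M"
  obtains P where "submodule_of R P M" "N \<inter> P = {\<zero>\<^bsub>M\<^esub>}"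
    "\<And>x. x \<in> carrier M \<Longrightarrow> \<exists>n\<in>N. \<exists>p\<in>P. x = n \<oplus>\<^bsub>M\<^esub> p"
proof -
  note N' = submodule_ofD[OF N]
  let ?A = "{P. submodule_of R P M \<and> N \<inter> P = {\<zero>\<^bsub>M\<^esub>}}"
  have "{\<zero>\<^bsub>M\<^esub>} \<in> ?A" using zero_submodule N'(2) by auto
  moreover have "\<Union>\<C> \<in> ?A" if "\<C> \<noteq> {}" "subset.chain ?A \<C>" for \<C>
  proof -
    have "subset.chain {N. submodule_of R N M} \<C>"
      using that(2) by (auto simp: subset_chain_def)
    moreover have "N \<inter> P = {\<zero>\<^bsub>M\<^esub>}" if "P \<in> \<C>" for P
      using \<open>subset.chain ?A \<C>\<close> that by (auto simp: subset_chain_def)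
    ultimately show ?thesis
      using that(1) submodule_Union_chain[OF that(1)] by blast
  qed
  ultimately obtain P where "P \<in> ?A" and max: "\<And>Q. Q \<in> ?A \<Longrightarrow> P \<subseteq> Q \<Longrightarrow> Q = P"
    using subset_Zorn_nonempty[of ?A] by (metis (no_types, lifting) empty_iff)
  then have P: "submodule_of R P M" and NP: "N \<inter> P = {\<zero>\<^bsub>M\<^esub>}" by auto
  note P' = submodule_ofD[OF P]
  define L where "L = {n \<oplus>\<^bsub>M\<^esub> p | n p. n \<in> N \<and> p \<in> P}"
  have L: "submodule_of R L M"
    unfolding L_def by (rule submodule_sum[OF N P])
  have PL: "P \<subseteq> L"
    using P'(1) N'(2) unfolding L_def by (smt (verit) M.l_zero mem_Collect_eq subsetI)
  have "S \<subseteq> L" if S: "submodule_of R S M" and simple: "simple_mod R (M\<lparr>carrier := S\<rparr>)" for S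
  proof -
    note S' = submodule_ofD[OF S]
    have "submodule_of R (S \<inter> L) (M\<lparr>carrier := S\<rparr>)"
      by (rule submodule_restrict[OF submodule_Int[OF S L] S]) blast
    with simple consider "S \<inter> L = S" | "S \<inter> L = {\<zero>\<^bsub>M\<^esub>}"
      unfolding simple_mod_def by auto
    then show ?thesis
    proof cases
      case 2
      define Q where "Q = {p \<oplus>\<^bsub>M\<^esub> s | p s. p \<in> P \<and> s \<in> S}"
      have Q: "submodule_of R Q M"
        unfolding Q_def by (rule submodule_sum[OF P S])
      have "x = \<zero>\<^bsub>M\<^esub>" if x: "x \<in> N" "x \<in> Q" for x
      proof -
        obtain p s where ps: "p \<in> P" "s \<in> S" "x = p \<oplus>\<^bsub>M\<^esub> s" using x(2) by (auto simp: Q_def)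
        \<comment> \<open>This puts \<open>s\<close> into both \<open>S\<close> and
          \<open>N + P\<close>, whose intersection is zero in this case.\<close>
        then have "s = x \<oplus>\<^bsub>M\<^esub> \<ominus>\<^bsub>M\<^esub> p"
          using P'(1) S'(1) by (simp add: M.a_comm M.r_neg1)
        then have "s \<in> L" using x(1) ps(1) P'(5) by (auto simp: L_def)
        then have "s = \<zero>\<^bsub>M\<^esub>" using 2 ps(2) by blast
        then have "x = p" using ps P'(1) by auto
        then show ?thesis using x(1) ps(1) NP by blast
      qed
      then have "Q \<in> ?A" using Q N'(2) submodule_ofD(2)[OF Q] by blast
      moreover have "P \<subseteq> Q"
        using P'(1) S'(2) unfolding Q_def by (smt (verit) M.r_zero mem_Collect_eq subsetI)
      ultimately have "Q = P" by (rule max)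
      moreover have "S \<subseteq> Q"
        using S'(1) P'(2) unfolding Q_def by (smt (verit) M.l_zero mem_Collect_eq subsetI)
      ultimately show ?thesis using PL by blast
    qed blast
  qed
  then have "carrier M \<subseteq> L"
    using socle_least[OF L] ss by blast
  then show ?thesis
    using that[OF P NP] unfolding L_def by blast
qed

section \<open>Dual Baer modules; maximal submodules\<close>

lemma end_ring_simps:
  "carrier (end_ring R M) = mod_hom R M M" "f \<otimes>\<^bsub>end_ring R M\<^esub> g = compose (carrier M) f g"
  by (simp_all add: end_ring_def)

text \<open>A complement \<open>P\<close> of \<open>N\<close> gives the projection \<open>e\<close>
  onto \<open>N\<close> along \<open>P\<close>. Composition with \<open>e\<close> fixes every
  homomorphism into \<open>N\<close>, so these homomorphisms are exactly the multiples
  \<open>e g\<close>.\<close>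

lemma semisimple_imp_dual_baer:
  assumes ss: "socle R M = carrier M"
  shows "dual_baer R M"
  unfolding dual_baer_def
proof (intro conjI allI impI right_module_axioms)
  fix N assume N: "submodule_of R N M"
  note N' = submodule_ofD[OF N]
  obtain P where P: "submodule_of R P M" and NP: "N \<inter> P = {\<zero>\<^bsub>M\<^esub>}"
    and sum: "\<And>x. x \<in> carrier M \<Longrightarrow> \<exists>n\<in>N. \<exists>p\<in>P. x = n \<oplus>\<^bsub>M\<^esub> p"
    by (rule semisimple_complement[OF ss N]) blast
  note P' = submodule_ofD[OF P]
  have unique: "n = n'" if "n \<in> N" "p \<in> P" "n' \<in> N" "p' \<in> P" "n \<oplus>\<^bsub>M\<^esub> p = n' \<oplus>\<^bsub>M\<^esub> p'" for n p n' p'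
  proof -
    have c: "n \<in> carrier M" "p \<in> carrier M" "n' \<in> carrier M" "p' \<in> carrier M"
      using that N'(1) P'(1) by auto
    have "n \<oplus>\<^bsub>M\<^esub> \<ominus>\<^bsub>M\<^esub> n' = (n \<oplus>\<^bsub>M\<^esub> p) \<oplus>\<^bsub>M\<^esub> \<ominus>\<^bsub>M\<^esub> p \<oplus>\<^bsub>M\<^esub> \<ominus>\<^bsub>M\<^esub> n'"
      using c by (simp add: M.a_assoc M.r_neg)
    also have "\<dots> = (n' \<oplus>\<^bsub>M\<^esub> \<ominus>\<^bsub>M\<^esub> n') \<oplus>\<^bsub>M\<^esub> (p' \<oplus>\<^bsub>M\<^esub> \<ominus>\<^bsub>M\<^esub> p)"
      unfolding that(5) using c by (simp add: M.a_ac)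
    also have "\<dots> = p' \<oplus>\<^bsub>M\<^esub> \<ominus>\<^bsub>M\<^esub> p"
      using c by (simp add: M.r_neg)
    \<comment> \<open>The same difference is \<open>n - n'\<close>, which lies in \<open>N\<close>,
      and \<open>p' - p\<close>, which lies in \<open>P\<close>.\<close>
    finally have "n \<oplus>\<^bsub>M\<^esub> \<ominus>\<^bsub>M\<^esub> n' \<in> N \<inter> P"
      using that N'(3,5) P'(3,5) by (metis IntI)
    then have "n \<oplus>\<^bsub>M\<^esub> \<ominus>\<^bsub>M\<^esub> n' = \<zero>\<^bsub>M\<^esub>" using NP by blast
    then show ?thesis using c by (metis M.add.inv_closed M.minus_equality M.minus_minus)
  qed
  define e where "e = (\<lambda>x\<in>carrier M. THE n. n \<in> N \<and> (\<exists>p\<in>P. x = n \<oplus>\<^bsub>M\<^esub> p))"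
  have e: "e (n \<oplus>\<^bsub>M\<^esub> p) = n" if "n \<in> N" "p \<in> P" for n p
    unfolding e_def using that N'(1) P'(1) by (auto intro!: the_equality dest: unique)
  have eN: "e n = n" if "n \<in> N" for n
    using e[OF that P'(2)] N'(1)[OF that] by simp
  have ext: "e \<in> extensional (carrier M)" by (simp add: e_def)
  have range: "e x \<in> N" if "x \<in> carrier M" for x
    using sum[OF that] e by auto
  have hom: "e \<in> mod_hom R M M"
  proof -
    have "e (x \<oplus>\<^bsub>M\<^esub> y) = e x \<oplus>\<^bsub>M\<^esub> e y" if x: "x \<in> carrier M" and y: "y \<in> carrier M" for x y
    proof -
      obtain n p n' p' where *: "n \<in> N" "p \<in> P" "n' \<in> N" "p' \<in> P"
        and xy: "x = n \<oplus>\<^bsub>M\<^esub> p" "y = n' \<oplus>\<^bsub>M\<^esub> p'"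
        using sum[OF x] sum[OF y] by blast
      have "x \<oplus>\<^bsub>M\<^esub> y = (n \<oplus>\<^bsub>M\<^esub> n') \<oplus>\<^bsub>M\<^esub> (p \<oplus>\<^bsub>M\<^esub> p')"
        unfolding xy using * N'(1) P'(1) by (simp add: M.a_ac)
      then show ?thesis using * e N'(3) P'(3) by (simp add: xy)
    qed
    moreover have "e (x \<cdot>\<^bsub>M\<^esub> a) = e x \<cdot>\<^bsub>M\<^esub> a" if x': "x \<in> carrier M" and a: "a \<in> carrier R" for x a
    proof -
      obtain n p where *: "n \<in> N" "p \<in> P" and x: "x = n \<oplus>\<^bsub>M\<^esub> p"
        using sum[OF x'] by blast
      have "x \<cdot>\<^bsub>M\<^esub> a = n \<cdot>\<^bsub>M\<^esub> a \<oplus>\<^bsub>M\<^esub> p \<cdot>\<^bsub>M\<^esub> a"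
        unfolding x using * a N'(1) P'(1) by (simp add: ract_add_module)
      then show ?thesis using * a e N'(4) P'(4) by (simp add: x)
    qed
    ultimately show ?thesis
      using ext range N'(1) by (auto simp: mod_hom_def PiE_iff)
  qed
  have "compose (carrier M) e e = e"
    by (rule mod_hom_eqI[OF compose_hom[OF hom hom] hom]) (simp add: compose_eq eN range)
  moreover have "mod_hom R M (M\<lparr>carrier := N\<rparr>) = e <#\<^bsub>end_ring R M\<^esub> carrier (end_ring R M)"
  proof (intro equalityI subsetI)
    fix f assume f: "f \<in> mod_hom R M (M\<lparr>carrier := N\<rparr>)"
    then have f': "f \<in> mod_hom R M M"
      by (rule mod_hom_enlarge_codomain) (use N'(1) in blast)
    have "f = compose (carrier M) e f"
      by (rule mod_hom_eqI[OF f' compose_hom[OF f' hom]])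
         (use mod_hom_closed[OF f] in \<open>simp add: compose_eq eN\<close>)
    then show "f \<in> e <#\<^bsub>end_ring R M\<^esub> carrier (end_ring R M)"
      using f' by (auto simp: l_coset_def end_ring_simps)
  next
    fix f assume "f \<in> e <#\<^bsub>end_ring R M\<^esub> carrier (end_ring R M)"
    then obtain g where g: "g \<in> mod_hom R M M" and f: "f = compose (carrier M) e g"
      by (auto simp: l_coset_def end_ring_simps)
    show "f \<in> mod_hom R M (M\<lparr>carrier := N\<rparr>)"
      unfolding f
      by (rule mod_hom_restrict_codomain[OF compose_hom[OF g hom]])
         (simp add: compose_eq range mod_hom_closed[OF g])
  qed
  ultimately show "\<exists>e\<in>carrier (end_ring R M). e \<otimes>\<^bsub>end_ring R M\<^esub> e = e \<and>
      mod_hom R M (M\<lparr>carrier := N\<rparr>) = e <#\<^bsub>end_ring R M\<^esub> carrier (end_ring R M)"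
    using hom by (auto simp: end_ring_simps)
qed

text \<open>Let \<open>Hom(M,N) = e S\<close> for the generated submodule \<open>N\<close>. From
  \<open>e = e e\<close> the image of \<open>e\<close> lies in \<open>N\<close>; conversely each
  \<open>f\<close> in \<open>E\<close> has the form \<open>e g\<close>, so the image of
  \<open>e\<close> contains all generators of \<open>N\<close>. For an arbitrary submodule the image
  of \<open>e\<close> can be strictly smaller, so generation by images of endomorphisms
  matters.\<close>

lemma dual_baer_projection:
  assumes db: "dual_baer R M" and E: "E \<subseteq> mod_hom R M M"
  obtains e where "e \<in> mod_hom R M M" "\<And>x. x \<in> carrier M \<Longrightarrow> e (e x) = e x"
    "e ` carrier M = gen_submodule R M (\<Union>f\<in>E. f ` carrier M)"
proof -
  define N where "N = gen_submodule R M (\<Union>f\<in>E. f ` carrier M)"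
  have "(\<Union>f\<in>E. f ` carrier M) \<subseteq> carrier M"
    using mod_hom_closed[OF subsetD[OF E]] by blast
  then have N: "submodule_of R N M"
    unfolding N_def by (rule gen_submodule_submodule)
  then obtain e where e: "e \<in> mod_hom R M M" and idem: "compose (carrier M) e e = e"
    and eq: "mod_hom R M (M\<lparr>carrier := N\<rparr>) = e <#\<^bsub>end_ring R M\<^esub> mod_hom R M M"
    using db unfolding dual_baer_def end_ring_simps by blast
  have ee: "e (e x) = e x" if "x \<in> carrier M" for x
    using fun_cong[OF idem, of x] that by (simp add: compose_eq)
  have "e \<in> e <#\<^bsub>end_ring R M\<^esub> mod_hom R M M"
    unfolding l_coset_def end_ring_simps using e by (auto intro!: bexI[of _ e] simp: idem)
  then have e': "e \<in> mod_hom R M (M\<lparr>carrier := N\<rparr>)" using eq by simp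
  have sub: "e ` carrier M \<subseteq> N"
    using mod_hom_closed[OF e'] by auto
  have "f ` carrier M \<subseteq> e ` carrier M" if f: "f \<in> E" for f
  proof -
    have "f ` carrier M \<subseteq> N"
      unfolding N_def using gen_submodule_superset f by (metis SUP_le_iff)
    then have "f \<in> mod_hom R M (M\<lparr>carrier := N\<rparr>)"
      using f E by (intro mod_hom_restrict_codomain) auto
    then obtain g where g: "g \<in> mod_hom R M M" "f = compose (carrier M) e g"
      unfolding eq by (auto simp: l_coset_def end_ring_simps)
    then show ?thesis using mod_hom_closed[OF g(1)] g(2) by (auto simp: compose_eq)
  qed
  then have "N \<subseteq> e ` carrier M"
    unfolding N_def by (intro gen_submodule_least image_submodule[OF e right_module_axioms]) auto
  with sub have "e ` carrier M = N" by (rule equalityI)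
  with e ee show ?thesis
    unfolding N_def by (intro that[of e])
qed

text \<open>Zorn's lemma is applied to the submodules that contain \<open>P\<close> but not the
  finite generating set \<open>X\<close>; failing to contain \<open>X\<close> is the same as being
  proper.\<close>

lemma fin_gen_maximal_submodule:
  assumes fg: "fin_gen R M" and P: "submodule_of R P M" "P \<noteq> carrier M"
  obtains L where "submodule_of R L M" "P \<subseteq> L" "L \<noteq> carrier M"
    "\<And>N. \<lbrakk>submodule_of R N M; L \<subseteq> N\<rbrakk> \<Longrightarrow> N = L \<or> N = carrier M"
proof -
  obtain X where X: "finite X" "X \<subseteq> carrier M" and gen: "gen_submodule R M X = carrier M"
    using fg by (auto simp: fin_gen_def)
  have proper: "X \<subseteq> N \<longleftrightarrow> N = carrier M" if "submodule_of R N M" for N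
    using gen_submodule_least[OF that, of X] submodule_subset[OF that] X(2) gen by auto
  let ?A = "{L. submodule_of R L M \<and> P \<subseteq> L \<and> \<not> X \<subseteq> L}"
  have "P \<in> ?A" using P proper by auto
  moreover have "\<Union>\<C> \<in> ?A" if ne: "\<C> \<noteq> {}" and chain: "subset.chain ?A \<C>" for \<C>
  proof -
    have sub: "submodule_of R N M \<and> P \<subseteq> N \<and> \<not> X \<subseteq> N" if "N \<in> \<C>" for N
      using chain that by (auto simp: subset_chain_def)
    \<comment> \<open>A finite set covered by a chain lies in one member of it.\<close>
    have "\<not> X \<subseteq> \<Union>\<C>"
      using finite_subset_Union_chain[OF X(1) _ ne chain] sub by blast
    moreover have "subset.chain {N. submodule_of R N M} \<C>"
      using chain by (auto simp: subset_chain_def)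
    ultimately show ?thesis
      using submodule_Union_chain[OF ne] ne sub by blast
  qed
  ultimately obtain L where "L \<in> ?A" and max: "\<And>Q. Q \<in> ?A \<Longrightarrow> L \<subseteq> Q \<Longrightarrow> Q = L"
    using subset_Zorn_nonempty[of ?A] by (metis (no_types, lifting) empty_iff)
  then have L: "submodule_of R L M" "P \<subseteq> L" "\<not> X \<subseteq> L" by auto
  have "N = L \<or> N = carrier M" if N: "submodule_of R N M" "L \<subseteq> N" for N
  proof (cases "X \<subseteq> N")
    case True
    then show ?thesis using proper[OF N(1)] by simp
  next
    case False
    then have "N \<in> ?A" using N L(2) by auto
    then show ?thesis using max[OF _ N(2)] by simp
  qed
  then show ?thesis
    using that[OF L(1,2)] proper[OF L(1)] L(3) by metis
qed

end

section \<open>Equivalences of module categories\<close>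

lemma iso_in_cancel_left:
  assumes C: "is_category C" and e: "iso_in C B B' e" and obj: "A \<in> Obj C" "B \<in> Obj C" "B' \<in> Obj C"
    and fg: "f \<in> Hom C A B" "g \<in> Hom C A B" and eq: "Comp C A B B' e f = Comp C A B B' e g"
  shows "f = g"
proof -
  obtain d where d: "e \<in> Hom C B B'" "d \<in> Hom C B' B" "Comp C B B' B d e = Ident C B"
    using e by (auto simp: iso_in_def)
  have "h = Comp C A B' B d (Comp C A B B' e h)" if "h \<in> Hom C A B" for h
    using C d that obj unfolding is_category_def by metis
  then show ?thesis using fg eq by metis
qed

lemma iso_in_cancel_right:
  assumes C: "is_category C" and e: "iso_in C A A' e" and obj: "A \<in> Obj C" "A' \<in> Obj C" "B \<in> Obj C"
    and fg: "f \<in> Hom C A' B" "g \<in> Hom C A' B" and eq: "Comp C A A' B f e = Comp C A A' B g e"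
  shows "f = g"
proof -
  obtain d where d: "e \<in> Hom C A A'" "d \<in> Hom C A' A" "Comp C A' A A' e d = Ident C A'"
    using e by (auto simp: iso_in_def)
  have "h = Comp C A' A B (Comp C A A' B h e) d" if "h \<in> Hom C A' B" for h
    using C d that obj unfolding is_category_def by metis
  then show ?thesis using fg eq by metis
qed

text \<open>Naturality of \<open>\<eta>\<close> makes F faithful, and that of
  \<open>\<epsilon>\<close> makes G faithful. For fullness, \<open>h\<close> is lifted to
  \<open>f\<close>, the inverse of \<open>\<eta> B\<close> after \<open>G h\<close> after
  \<open>\<eta> A\<close>; naturality gives \<open>G F f = G h\<close>, and faithfulness of G gives
  \<open>F f = h\<close>. Density comes from the components of \<open>\<epsilon>\<close>.\<close>

lemma equivalence_fully_faithful_dense: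
  assumes C: "is_category C" and D: "is_category D" and equiv: "equivalent_categories C D"
  obtains Fo Fm where "is_functor C D Fo Fm"
    "\<And>A B f g. \<lbrakk>A \<in> Obj C; B \<in> Obj C; f \<in> Hom C A B; g \<in> Hom C A B; Fm A B f = Fm A B g\<rbrakk> \<Longrightarrow> f = g"
    "\<And>A B h. \<lbrakk>A \<in> Obj C; B \<in> Obj C; h \<in> Hom D (Fo A) (Fo B)\<rbrakk> \<Longrightarrow> \<exists>f\<in>Hom C A B. Fm A B f = h"
    "\<And>W. W \<in> Obj D \<Longrightarrow> \<exists>A\<in>Obj C. \<exists>i. iso_in D (Fo A) W i"
proof -
  obtain Fo Fm Go Gm \<eta> \<epsilon> where F: "is_functor C D Fo Fm" and G: "is_functor D C Go Gm"
    and \<eta>: "nat_iso C C (\<lambda>A. A) (\<lambda>A B f. f) (\<lambda>A. Go (Fo A)) (\<lambda>A B f. Gm (Fo A) (Fo B) (Fm A B f)) \<eta>"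
    and \<epsilon>: "nat_iso D D (\<lambda>A. Fo (Go A)) (\<lambda>A B f. Fm (Go A) (Go B) (Gm A B f)) (\<lambda>A. A) (\<lambda>A B f. f) \<epsilon>"
    using equiv unfolding equivalent_categories_def by blast
  have Fo: "Fo A \<in> Obj D" if "A \<in> Obj C" for A
    using F that by (simp add: is_functor_def)
  have Fm: "Fm A B f \<in> Hom D (Fo A) (Fo B)" if "A \<in> Obj C" "B \<in> Obj C" "f \<in> Hom C A B" for A B f
    using F that by (simp add: is_functor_def)
  have Go: "Go A \<in> Obj C" if "A \<in> Obj D" for A
    using G that by (simp add: is_functor_def)
  have Gm: "Gm A B f \<in> Hom C (Go A) (Go B)" if "A \<in> Obj D" "B \<in> Obj D" "f \<in> Hom D A B" for A B f
    using G that by (simp add: is_functor_def)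
  have \<eta>_iso: "iso_in C A (Go (Fo A)) (\<eta> A)" if "A \<in> Obj C" for A
    using \<eta> that by (simp add: nat_iso_def)
  have \<eta>_nat: "Comp C A B (Go (Fo B)) (\<eta> B) f =
      Comp C A (Go (Fo A)) (Go (Fo B)) (Gm (Fo A) (Fo B) (Fm A B f)) (\<eta> A)"
    if "A \<in> Obj C" "B \<in> Obj C" "f \<in> Hom C A B" for A B f
    using \<eta> that by (simp add: nat_iso_def)
  have \<epsilon>_iso: "iso_in D (Fo (Go A)) A (\<epsilon> A)" if "A \<in> Obj D" for A
    using \<epsilon> that by (simp add: nat_iso_def)
  have \<epsilon>_nat: "Comp D (Fo (Go A)) (Fo (Go B)) B (\<epsilon> B) (Fm (Go A) (Go B) (Gm A B f)) =
      Comp D (Fo (Go A)) A B f (\<epsilon> A)"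
    if "A \<in> Obj D" "B \<in> Obj D" "f \<in> Hom D A B" for A B f
    using \<epsilon> that by (simp add: nat_iso_def)
  have F_faithful: "f = g"
    if "A \<in> Obj C" "B \<in> Obj C" "f \<in> Hom C A B" "g \<in> Hom C A B" "Fm A B f = Fm A B g" for A B f g
  proof -
    have "Comp C A B (Go (Fo B)) (\<eta> B) f = Comp C A B (Go (Fo B)) (\<eta> B) g"
      unfolding \<eta>_nat[OF that(1,2,3)] \<eta>_nat[OF that(1,2,4)] that(5) by (rule refl)
    then show ?thesis
      by (rule iso_in_cancel_left[OF C \<eta>_iso[OF that(2)] that(1,2) Go[OF Fo[OF that(2)]] that(3,4)])
  qed
  have G_faithful: "f = g"
    if "A \<in> Obj D" "B \<in> Obj D" "f \<in> Hom D A B" "g \<in> Hom D A B" "Gm A B f = Gm A B g" for A B f g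
  proof -
    have "Comp D (Fo (Go A)) A B f (\<epsilon> A) = Comp D (Fo (Go A)) A B g (\<epsilon> A)"
      unfolding \<epsilon>_nat[OF that(1,2,3), symmetric] \<epsilon>_nat[OF that(1,2,4), symmetric] that(5)
      by (rule refl)
    then show ?thesis
      by (rule iso_in_cancel_right[OF D \<epsilon>_iso[OF that(1)] Fo[OF Go[OF that(1)]] that(1-4)])
  qed
  have full: "\<exists>f\<in>Hom C A B. Fm A B f = h"
    if A: "A \<in> Obj C" and B: "B \<in> Obj C" and h: "h \<in> Hom D (Fo A) (Fo B)" for A B h
  proof -
    let ?A = "Go (Fo A)" and ?B = "Go (Fo B)"
    have objs: "?A \<in> Obj C" "?B \<in> Obj C" using A B Go Fo by auto
    obtain d where d: "d \<in> Hom C ?B B" "\<eta> B \<in> Hom C B ?B" "Comp C ?B B ?B (\<eta> B) d = Ident C ?B"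
      using \<eta>_iso[OF B] by (auto simp: iso_in_def)
    have eA: "\<eta> A \<in> Hom C A ?A" using \<eta>_iso[OF A] by (simp add: iso_in_def)
    have Gh: "Gm (Fo A) (Fo B) h \<in> Hom C ?A ?B" using A B h Gm Fo by auto
    define k where "k = Comp C A ?A ?B (Gm (Fo A) (Fo B) h) (\<eta> A)"
    have k: "k \<in> Hom C A ?B"
      using C A objs Gh eA unfolding is_category_def k_def by blast
    define f where "f = Comp C A ?B B d k"
    have f: "f \<in> Hom C A B"
      using C A B objs k d(1) unfolding is_category_def f_def by blast
    have "Comp C A B ?B (\<eta> B) f = Comp C A ?B ?B (Comp C ?B B ?B (\<eta> B) d) k"
      using C A B objs k d(1,2) unfolding is_category_def f_def by simp
    also have "\<dots> = k"
      unfolding d(3) using C A objs k unfolding is_category_def by simp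
    finally have "Comp C A ?A ?B (Gm (Fo A) (Fo B) (Fm A B f)) (\<eta> A) =
        Comp C A ?A ?B (Gm (Fo A) (Fo B) h) (\<eta> A)"
      using \<eta>_nat[OF A B f] by (simp add: k_def)
    then have "Gm (Fo A) (Fo B) (Fm A B f) = Gm (Fo A) (Fo B) h"
      by (rule iso_in_cancel_right[OF C \<eta>_iso[OF A] A objs Gm[OF Fo[OF A] Fo[OF B] Fm[OF A B f]] Gh])
    then have "Fm A B f = h"
      by (rule G_faithful[OF Fo[OF A] Fo[OF B] Fm[OF A B f] h])
    then show ?thesis using f by blast
  qed
  show ?thesis
  proof (rule that[OF F F_faithful full])
    show "\<exists>A\<in>Obj C. \<exists>i. iso_in D (Fo A) W i" if "W \<in> Obj D" for W
      using Go[OF that] \<epsilon>_iso[OF that] by blast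
  qed
qed

text \<open>Translates the equivalence into module language and keeps only one of the two functors.
  An isomorphism is given in \<open>dense\<close> by two mutually inverse homomorphisms, the form in
  which it is applied.\<close>

locale module_equivalence =
  fixes R :: "('r, 'x) ring_scheme" and T :: "('t, 'y) ring_scheme"
    and Fo :: "('r, 'u) rmod \<Rightarrow> ('t, 'u) rmod"
    and Fm :: "('r, 'u) rmod \<Rightarrow> ('r, 'u) rmod \<Rightarrow> ('u \<Rightarrow> 'u) \<Rightarrow> 'u \<Rightarrow> 'u"
  assumes T_cring: "cring T"
    and obj: "right_module R A \<Longrightarrow> right_module T (Fo A)"
    and mor: "\<lbrakk>right_module R A; right_module R B; f \<in> mod_hom R A B\<rbrakk>
        \<Longrightarrow> Fm A B f \<in> mod_hom T (Fo A) (Fo B)"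
    and ident: "right_module R A \<Longrightarrow> Fm A A (\<lambda>x\<in>carrier A. x) = (\<lambda>x\<in>carrier (Fo A). x)"
    and comp: "\<lbrakk>right_module R A; right_module R B; right_module R D;
          f \<in> mod_hom R A B; g \<in> mod_hom R B D\<rbrakk>
        \<Longrightarrow> Fm A D (compose (carrier A) g f) = compose (carrier (Fo A)) (Fm B D g) (Fm A B f)"
    and faithful: "\<lbrakk>right_module R A; right_module R B; f \<in> mod_hom R A B; g \<in> mod_hom R A B;
          Fm A B f = Fm A B g\<rbrakk> \<Longrightarrow> f = g"
    and full: "\<lbrakk>right_module R A; right_module R B; h \<in> mod_hom T (Fo A) (Fo B)\<rbrakk>
        \<Longrightarrow> \<exists>f\<in>mod_hom R A B. Fm A B f = h"
    and dense: "\<And>W :: ('t, 'u) rmod. right_module T W \<Longrightarrow> \<exists>A. right_module R A \<and>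
          (\<exists>i\<in>mod_hom T (Fo A) W. \<exists>j\<in>mod_hom T W (Fo A).
             (\<forall>x\<in>carrier (Fo A). j (i x) = x) \<and> (\<forall>y\<in>carrier W. i (j y) = y))"

lemma morita_equivalent_module_equivalence:
  fixes R :: "('r, 'x) ring_scheme" and T :: "('t, 'y) ring_scheme"
  assumes "cring T" "morita_equivalent TYPE('u) R T"
  obtains Fo and Fm :: "('r, 'u) rmod \<Rightarrow> _" where "module_equivalence R T Fo Fm"
proof -
  let ?C = "mod_cat R :: (('r, 'u) rmod, 'u \<Rightarrow> 'u) cat"
  let ?D = "mod_cat T :: (('t, 'u) rmod, 'u \<Rightarrow> 'u) cat"
  obtain Fo Fm where F: "is_functor ?C ?D Fo Fm"
    and faithful: "\<And>A B f g. \<lbrakk>A \<in> Obj ?C; B \<in> Obj ?C; f \<in> Hom ?C A B; g \<in> Hom ?C A B; Fm A B f = Fm A B g\<rbrakk> \<Longrightarrow> f = g"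
    and full: "\<And>A B h. \<lbrakk>A \<in> Obj ?C; B \<in> Obj ?C; h \<in> Hom ?D (Fo A) (Fo B)\<rbrakk> \<Longrightarrow> \<exists>f\<in>Hom ?C A B. Fm A B f = h"
    and dense: "\<And>W. W \<in> Obj ?D \<Longrightarrow> \<exists>A\<in>Obj ?C. \<exists>i. iso_in ?D (Fo A) W i"
    using equivalence_fully_faithful_dense[OF mod_cat_is_category mod_cat_is_category]
      assms(2) unfolding morita_equivalent_def by blast
  have "module_equivalence R T Fo Fm"
  proof (rule module_equivalence.intro)
    fix W :: "('t, 'u) rmod" assume W: "right_module T W"
    then obtain A i where A: "right_module R A" and i: "iso_in ?D (Fo A) W i"
      using dense[of W] by (auto simp: mod_cat_def)
    then obtain j where hom: "i \<in> mod_hom T (Fo A) W" "j \<in> mod_hom T W (Fo A)"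
      and ji: "compose (carrier (Fo A)) j i = (\<lambda>x\<in>carrier (Fo A). x)"
      and ij: "compose (carrier W) i j = (\<lambda>x\<in>carrier W. x)"
      by (auto simp: iso_in_def mod_cat_def)
    have "j (i x) = x" if "x \<in> carrier (Fo A)" for x
      using fun_cong[OF ji, of x] that by (simp add: compose_eq)
    moreover have "i (j y) = y" if "y \<in> carrier W" for y
      using fun_cong[OF ij, of y] that by (simp add: compose_eq)
    ultimately show "\<exists>A. right_module R A \<and> (\<exists>i\<in>mod_hom T (Fo A) W. \<exists>j\<in>mod_hom T W (Fo A).
        (\<forall>x\<in>carrier (Fo A). j (i x) = x) \<and> (\<forall>y\<in>carrier W. i (j y) = y))"
      using A hom by blast
  next
    fix A B :: "('r, 'u) rmod" and f g
    assume "right_module R A" "right_module R B" "f \<in> mod_hom R A B" "g \<in> mod_hom R A B"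
      "Fm A B f = Fm A B g"
    then show "f = g" using faithful[of A B f g] by (simp add: mod_cat_def)
  next
    fix A B :: "('r, 'u) rmod" and h
    assume "right_module R A" "right_module R B" "h \<in> mod_hom T (Fo A) (Fo B)"
    then show "\<exists>f\<in>mod_hom R A B. Fm A B f = h" using full[of A B h] by (simp add: mod_cat_def)
  qed (use assms(1) F in \<open>simp_all add: is_functor_def mod_cat_def\<close>)
  then show ?thesis by (rule that)
qed

section \<open>Zero maps and scalars of \<open>T\<close> through the functor\<close>

context module_equivalence
begin

text \<open>Linearity over \<open>T\<close> amounts to \<open>x a t = x t a\<close>, which holds
  because \<open>T\<close> is commutative.\<close>

lemma scalar_hom:
  assumes "right_module T W" "t \<in> carrier T"
  shows "(\<lambda>x\<in>carrier W. x \<cdot>\<^bsub>W\<^esub> t) \<in> mod_hom T W W"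
proof -
  interpret T: cring T by (rule T_cring)
  interpret W: right_module T W by fact
  have "(x \<cdot>\<^bsub>W\<^esub> a) \<cdot>\<^bsub>W\<^esub> t = (x \<cdot>\<^bsub>W\<^esub> t) \<cdot>\<^bsub>W\<^esub> a" if "x \<in> carrier W" "a \<in> carrier T" for x a
    using that assms(2) T.m_comm[of a t] by (simp flip: W.ract_mult)
  then show ?thesis
    using assms(2) by (intro W.restrict_in_mod_hom) (auto simp: W.ract_closed W.ract_add_module)
qed

text \<open>Fullness makes the zero endomorphism of \<open>Fo A\<close> the image of some \<open>g\<close>, and \<open>0 \<circ> g = 0 \<circ> id\<close>;
  so no additivity of the functor is needed.\<close>

lemma mor_zero:
  assumes A: "right_module R A" and B: "right_module R B"
  shows "Fm A B (\<lambda>x\<in>carrier A. \<zero>\<^bsub>B\<^esub>) = (\<lambda>x\<in>carrier (Fo A). \<zero>\<^bsub>Fo B\<^esub>)"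
proof -
  interpret A: right_module R A by fact
  interpret FA: right_module T "Fo A" by (rule obj[OF A])
  have z: "(\<lambda>x\<in>carrier A. \<zero>\<^bsub>B\<^esub>) \<in> mod_hom R A B" by (rule A.zero_hom[OF B])
  obtain g where g: "g \<in> mod_hom R A A" "Fm A A g = (\<lambda>x\<in>carrier (Fo A). \<zero>\<^bsub>Fo A\<^esub>)"
    using full[OF A A FA.zero_hom[OF obj[OF A]]] by blast
  have "compose (carrier A) (\<lambda>x\<in>carrier A. \<zero>\<^bsub>B\<^esub>) g = (\<lambda>x\<in>carrier A. \<zero>\<^bsub>B\<^esub>)"
    using mod_hom_closed[OF g(1)] by (auto simp: compose_def)
  then have "Fm A B (\<lambda>x\<in>carrier A. \<zero>\<^bsub>B\<^esub>) =
      compose (carrier (Fo A)) (Fm A B (\<lambda>x\<in>carrier A. \<zero>\<^bsub>B\<^esub>)) (\<lambda>x\<in>carrier (Fo A). \<zero>\<^bsub>Fo A\<^esub>)"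
    using comp[OF A A B g(1) z] g(2) by simp
  also have "\<dots> = (\<lambda>x\<in>carrier (Fo A). \<zero>\<^bsub>Fo B\<^esub>)"
    using FA.hom_zero[OF mor[OF A B z] obj[OF B]] by (auto simp: compose_def)
  finally show ?thesis .
qed

text \<open>Combines faithfulness with \<open>mor_zero\<close>. It carries vanishing statements
  between the two sides and, with \<open>mor_compose_eq_zero\<close>, stands in for exactness of the
  functor.\<close>

lemma mor_eq_zero_iff:
  assumes A: "right_module R A" and B: "right_module R B" and f: "f \<in> mod_hom R A B"
  shows "(\<forall>y\<in>carrier (Fo A). Fm A B f y = \<zero>\<^bsub>Fo B\<^esub>) \<longleftrightarrow> (\<forall>x\<in>carrier A. f x = \<zero>\<^bsub>B\<^esub>)"
proof -
  have zA: "(\<lambda>x\<in>carrier A. \<zero>\<^bsub>B\<^esub>) \<in> mod_hom R A B"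
    and zF: "(\<lambda>x\<in>carrier (Fo A). \<zero>\<^bsub>Fo B\<^esub>) \<in> mod_hom T (Fo A) (Fo B)"
    by (rule right_module.zero_hom; simp add: A B obj)+
  have "(\<forall>y\<in>carrier (Fo A). Fm A B f y = \<zero>\<^bsub>Fo B\<^esub>)
      \<longleftrightarrow> Fm A B f = (\<lambda>x\<in>carrier (Fo A). \<zero>\<^bsub>Fo B\<^esub>)"
    using mod_hom_eqI[OF mor[OF A B f] zF] by auto
  also have "\<dots> \<longleftrightarrow> f = (\<lambda>x\<in>carrier A. \<zero>\<^bsub>B\<^esub>)"
    using faithful[OF A B f zA] mor_zero[OF A B] by auto
  also have "\<dots> \<longleftrightarrow> (\<forall>x\<in>carrier A. f x = \<zero>\<^bsub>B\<^esub>)"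
    using mod_hom_eqI[OF f zA] by auto
  finally show ?thesis .
qed

lemma mor_compose_eq_zero:
  assumes A: "right_module R A" and B: "right_module R B" and D: "right_module R D"
    and f: "f \<in> mod_hom R A B" and g: "g \<in> mod_hom R B D"
  shows "(\<forall>y\<in>carrier (Fo A). Fm B D g (Fm A B f y) = \<zero>\<^bsub>Fo D\<^esub>)
      \<longleftrightarrow> (\<forall>x\<in>carrier A. g (f x) = \<zero>\<^bsub>D\<^esub>)"
  using mor_eq_zero_iff[OF A D right_module.compose_hom[OF A f g]]
  by (simp add: comp[OF A B D f g] compose_eq)

text \<open>Full faithfulness gives exactly one endomorphism of a right \<open>R\<close>-module
  \<open>A\<close> lying over multiplication by \<open>t\<close>, so the description is well
  defined. It plays the role of multiplication by a central element of \<open>R\<close>.\<close>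

definition zeta :: "'t \<Rightarrow> ('r, 'u) rmod \<Rightarrow> 'u \<Rightarrow> 'u" where
  "zeta t A = (THE f. f \<in> mod_hom R A A \<and> Fm A A f = (\<lambda>x\<in>carrier (Fo A). x \<cdot>\<^bsub>Fo A\<^esub> t))"

lemma zeta:
  assumes A: "right_module R A" and t: "t \<in> carrier T"
  shows zeta_hom: "zeta t A \<in> mod_hom R A A"
    and mor_zeta: "Fm A A (zeta t A) = (\<lambda>x\<in>carrier (Fo A). x \<cdot>\<^bsub>Fo A\<^esub> t)"
proof -
  have "\<exists>!f. f \<in> mod_hom R A A \<and> Fm A A f = (\<lambda>x\<in>carrier (Fo A). x \<cdot>\<^bsub>Fo A\<^esub> t)"
    using full[OF A A scalar_hom[OF obj[OF A] t]] faithful[OF A A] by metis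
  from theI'[OF this]
  show "zeta t A \<in> mod_hom R A A"
    and "Fm A A (zeta t A) = (\<lambda>x\<in>carrier (Fo A). x \<cdot>\<^bsub>Fo A\<^esub> t)"
    by (simp_all add: zeta_def)
qed

text \<open>The map \<open>Fm A B f\<close> is \<open>T\<close>-linear and so commutes with
  multiplication by \<open>t\<close>; faithfulness brings this back to \<open>f\<close>.\<close>

lemma zeta_natural:
  assumes A: "right_module R A" and B: "right_module R B" and t: "t \<in> carrier T"
    and f: "f \<in> mod_hom R A B" and x: "x \<in> carrier A"
  shows "f (zeta t A x) = zeta t B (f x)"
proof -
  interpret A: right_module R A by fact
  interpret FA: right_module T "Fo A" by (rule obj[OF A])
  note Ff = mor[OF A B f]
  have "compose (carrier A) f (zeta t A) = compose (carrier A) (zeta t B) f"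
  proof (rule faithful[OF A B A.compose_hom[OF zeta_hom[OF A t] f] A.compose_hom[OF f zeta_hom[OF B t]]])
    show "Fm A B (compose (carrier A) f (zeta t A)) = Fm A B (compose (carrier A) (zeta t B) f)"
      unfolding comp[OF A A B zeta_hom[OF A t] f] comp[OF A B B f zeta_hom[OF B t]]
        mor_zeta[OF A t] mor_zeta[OF B t]
      using t mod_hom_closed[OF Ff] mod_hom_act[OF Ff] by (auto simp: compose_def FA.ract_closed)
  qed
  from fun_cong[OF this, of x] x show ?thesis by (simp add: compose_eq)
qed

text \<open>On the right module \<open>Fo A\<close> the product \<open>s t\<close> acts by
  \<open>s\<close> first, the composite by \<open>t\<close> first. Commutativity of \<open>T\<close>
  reconciles the two orders.\<close>

lemma zeta_mult:
  assumes A: "right_module R A" and s: "s \<in> carrier T" and t: "t \<in> carrier T" and x: "x \<in> carrier A"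
  shows "zeta (s \<otimes>\<^bsub>T\<^esub> t) A x = zeta s A (zeta t A x)"
proof -
  interpret T: cring T by (rule T_cring)
  interpret A: right_module R A by fact
  interpret FA: right_module T "Fo A" by (rule obj[OF A])
  have "zeta (s \<otimes>\<^bsub>T\<^esub> t) A = compose (carrier A) (zeta s A) (zeta t A)"
  proof (rule faithful[OF A A zeta_hom[OF A] A.compose_hom[OF zeta_hom[OF A t] zeta_hom[OF A s]]])
    show "Fm A A (zeta (s \<otimes>\<^bsub>T\<^esub> t) A) = Fm A A (compose (carrier A) (zeta s A) (zeta t A))"
      unfolding comp[OF A A A zeta_hom[OF A t] zeta_hom[OF A s]]
      using s t by (auto simp: compose_def mor_zeta[OF A] T.m_comm[of s t] FA.ract_mult FA.ract_closed)
  qed (use s t in simp)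
  from fun_cong[OF this, of x] x show ?thesis by (simp add: compose_eq)
qed

section \<open>Annihilators and simple modules under the equivalence\<close>

lemma zeta_eq_zero_iff:
  assumes "right_module R A" "t \<in> carrier T"
  shows "(\<forall>x\<in>carrier A. zeta t A x = \<zero>\<^bsub>A\<^esub>) \<longleftrightarrow> (\<forall>y\<in>carrier (Fo A). y \<cdot>\<^bsub>Fo A\<^esub> t = \<zero>\<^bsub>Fo A\<^esub>)"
  using mor_eq_zero_iff[OF assms(1,1) zeta_hom[OF assms]] by (simp add: mor_zeta[OF assms])

text \<open>The inclusion of \<open>N\<close> and the projection onto \<open>Fo V / N\<close> come,
  up to isomorphism, from homomorphisms \<open>f\<close> into \<open>V\<close> and \<open>g\<close>
  out of \<open>V\<close> with \<open>g f = 0\<close>. Simplicity of \<open>V\<close> forces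
  \<open>f = 0\<close>, whence \<open>N = 0\<close>, or \<open>f\<close> onto, whence
  \<open>g = 0\<close> and \<open>N\<close> is everything.\<close>

lemma simple_submodule_obj:
  assumes simple: "simple_mod R V" and N: "submodule_of T N (Fo V)"
  shows "N = {\<zero>\<^bsub>Fo V\<^esub>} \<or> N = carrier (Fo V)"
proof -
  have V: "right_module R V" using simple by (simp add: simple_mod_def)
  interpret FV: right_module T "Fo V" by (rule obj[OF V])
  note N' = FV.submodule_ofD[OF N]
  obtain Q :: "('t, 'u) rmod" and q where Q: "right_module T Q" and q: "q \<in> mod_hom T (Fo V) Q"
    and ker: "{x \<in> carrier (Fo V). q x = \<zero>\<^bsub>Q\<^esub>} = N"
    by (rule FV.quotient_exists[OF N subset_imp_lepoll[OF subset_UNIV]])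
  obtain A i i' where A: "right_module R A" and i: "i \<in> mod_hom T (Fo A) (Fo V\<lparr>carrier := N\<rparr>)"
    and i': "i' \<in> mod_hom T (Fo V\<lparr>carrier := N\<rparr>) (Fo A)" "\<And>y. y \<in> N \<Longrightarrow> i (i' y) = y"
    using dense[OF FV.submodule_is_module[OF N]] by auto
  obtain B j j' where B: "right_module R B" and j': "j' \<in> mod_hom T Q (Fo B)"
    and j: "j \<in> mod_hom T (Fo B) Q" "\<And>y. y \<in> carrier Q \<Longrightarrow> j (j' y) = y"
    using dense[OF Q] by auto
  interpret FA: right_module T "Fo A" by (rule obj[OF A])
  have "i \<in> mod_hom T (Fo A) (Fo V)"
    by (rule FA.mod_hom_enlarge_codomain[OF i]) (use N'(1) in blast)
  then obtain f where f: "f \<in> mod_hom R A V" "Fm A V f = i"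
    using full[OF A V] by blast
  obtain g where g: "g \<in> mod_hom R V B" "Fm V B g = compose (carrier (Fo V)) j' q"
    using full[OF V B FV.compose_hom[OF q j']] by blast
  have j'0: "j' \<zero>\<^bsub>Q\<^esub> = \<zero>\<^bsub>Fo B\<^esub>"
    by (rule right_module.hom_zero[OF Q j' obj[OF B]])
  have j0: "j \<zero>\<^bsub>Fo B\<^esub> = \<zero>\<^bsub>Q\<^esub>"
    by (rule right_module.hom_zero[OF obj[OF B] j(1) Q])
  have "i y \<in> N" if "y \<in> carrier (Fo A)" for y
    using mod_hom_closed[OF i that] by simp
  then have "\<forall>y\<in>carrier (Fo A). Fm V B g (Fm A V f y) = \<zero>\<^bsub>Fo B\<^esub>"
    using ker j'0 by (auto simp: f(2) g(2) compose_def)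
  then have gf: "g (f x) = \<zero>\<^bsub>B\<^esub>" if "x \<in> carrier A" for x
    using mor_compose_eq_zero[OF A V B f(1) g(1)] that by blast
  from right_module.image_submodule[OF A f(1) V] simple
  consider "f ` carrier A = {\<zero>\<^bsub>V\<^esub>}" | "f ` carrier A = carrier V"
    unfolding simple_mod_def by blast
  then show ?thesis
  proof cases
    case 1
    then have "\<forall>y\<in>carrier (Fo A). i y = \<zero>\<^bsub>Fo V\<^esub>"
      using mor_eq_zero_iff[OF A V f(1)] f(2) by auto
    moreover have "i' y \<in> carrier (Fo A)" if "y \<in> N" for y
      using mod_hom_closed[OF i'(1)] that by simp
    ultimately have "N \<subseteq> {\<zero>\<^bsub>Fo V\<^esub>}"
      using i'(2) by (metis singleton_iff subsetI)
    then show ?thesis using N'(2) by blast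
  next
    case 2
    then have "\<forall>x\<in>carrier V. g x = \<zero>\<^bsub>B\<^esub>" using gf by (metis imageE)
    then have "\<forall>y\<in>carrier (Fo V). j' (q y) = \<zero>\<^bsub>Fo B\<^esub>"
      using mor_eq_zero_iff[OF V B g(1)] by (simp add: g(2) compose_eq)
    then have "\<forall>y\<in>carrier (Fo V). q y = \<zero>\<^bsub>Q\<^esub>"
      using j(2) j0 mod_hom_closed[OF q] by metis
    then show ?thesis using ker by blast
  qed
qed

lemma simple_obj_cyclic:
  assumes simple: "simple_mod R V"
  obtains v where "v \<in> carrier (Fo V)" "(\<lambda>a. v \<cdot>\<^bsub>Fo V\<^esub> a) ` carrier T = carrier (Fo V)"
proof -
  interpret FV: right_module T "Fo V"
    using simple by (intro obj) (simp add: simple_mod_def)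
  show ?thesis
  proof (cases "carrier (Fo V) = {\<zero>\<^bsub>Fo V\<^esub>}")
    \<comment> \<open>\<open>simple_submodule_obj\<close> leaves open whether \<open>Fo V\<close> is
      zero; in that case zero is a generator.\<close>
    case True
    have "(\<lambda>a. \<zero>\<^bsub>Fo V\<^esub> \<cdot>\<^bsub>Fo V\<^esub> a) ` carrier T = {\<zero>\<^bsub>Fo V\<^esub>}"
      using FV.zero_ract FV.R.zero_closed by (auto simp: image_iff)
    then show ?thesis using that[OF FV.M.zero_closed] True by simp
  next
    case False
    then obtain v where v: "v \<in> carrier (Fo V)" "v \<noteq> \<zero>\<^bsub>Fo V\<^esub>"
      using FV.M.zero_closed by blast
    have "v \<in> (\<lambda>a. v \<cdot>\<^bsub>Fo V\<^esub> a) ` carrier T"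
      using FV.ract_one[OF v(1)] by (metis FV.R.one_closed image_eqI)
    then show ?thesis
      using simple_submodule_obj[OF simple FV.cyclic_submodule[OF v(1)]] v that by blast
  qed
qed

text \<open>\<open>Fo V\<close> is cyclic, so every element of \<open>Fo K\<close> lies in the image of a homomorphism from \<open>Fo V\<close>;
  by fullness these come from homomorphisms from \<open>V\<close> to \<open>K\<close>.\<close>

lemma killed_by_annihilator_of_simple:
  assumes simple: "simple_mod R V" and K: "right_module R K"
    and kill: "\<And>t. \<lbrakk>t \<in> carrier T; \<forall>v\<in>carrier V. zeta t V v = \<zero>\<^bsub>V\<^esub>\<rbrakk>
        \<Longrightarrow> \<forall>x\<in>carrier K. zeta t K x = \<zero>\<^bsub>K\<^esub>"
  shows "socle R K = carrier K"
proof -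
  interpret T: cring T by (rule T_cring)
  have V: "right_module R V" using simple by (simp add: simple_mod_def)
  interpret K: right_module R K by fact
  interpret FV: right_module T "Fo V" by (rule obj[OF V])
  interpret FK: right_module T "Fo K" by (rule obj[OF K])
  obtain Q :: "('r, 'u) rmod" and q where Q: "right_module R Q" and q: "q \<in> mod_hom R K Q"
    and ker: "{x \<in> carrier K. q x = \<zero>\<^bsub>Q\<^esub>} = socle R K"
    by (rule K.quotient_exists[OF K.socle_submodule subset_imp_lepoll[OF subset_UNIV]])
  obtain v where v: "v \<in> carrier (Fo V)" and cyclic: "(\<lambda>a. v \<cdot>\<^bsub>Fo V\<^esub> a) ` carrier T = carrier (Fo V)"
    by (rule simple_obj_cyclic[OF simple])
  \<comment> \<open>The projection \<open>q\<close> modulo the socle is shown to be zero by showing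
    that its image under the functor is zero.\<close>
  have "Fm K Q q x = \<zero>\<^bsub>Fo Q\<^esub>" if x: "x \<in> carrier (Fo K)" for x
  proof -
    \<comment> \<open>Makes the assignment of \<open>x a\<close> to \<open>v a\<close> well defined.
      The difference \<open>c\<close> of the scalars kills the generator \<open>v\<close>, hence all
      of \<open>Fo V\<close> since \<open>T\<close> is commutative, hence \<open>V\<close> under
      \<open>zeta\<close>, and by \<open>kill\<close> also \<open>K\<close>.\<close>
    have wd: "x \<cdot>\<^bsub>Fo K\<^esub> a = x \<cdot>\<^bsub>Fo K\<^esub> b"
      if a: "a \<in> carrier T" and b: "b \<in> carrier T" and eq: "v \<cdot>\<^bsub>Fo V\<^esub> a = v \<cdot>\<^bsub>Fo V\<^esub> b" for a b
    proof -
      define c where "c = a \<oplus>\<^bsub>T\<^esub> \<ominus>\<^bsub>T\<^esub> b"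
      have c: "c \<in> carrier T" and a_eq: "a = c \<oplus>\<^bsub>T\<^esub> b"
        using a b by (simp_all add: c_def T.a_assoc T.l_neg)
      have "v \<cdot>\<^bsub>Fo V\<^esub> c = \<zero>\<^bsub>Fo V\<^esub>"
        using eq b c v unfolding a_eq
        by (metis FV.M.add.l_cancel_one FV.M.a_comm FV.ract_add_ring FV.ract_closed)
      have "y \<cdot>\<^bsub>Fo V\<^esub> c = \<zero>\<^bsub>Fo V\<^esub>" if y: "y \<in> carrier (Fo V)" for y
      proof -
        obtain d where d: "d \<in> carrier T" "y = v \<cdot>\<^bsub>Fo V\<^esub> d" using y cyclic by blast
        then have "y \<cdot>\<^bsub>Fo V\<^esub> c = (v \<cdot>\<^bsub>Fo V\<^esub> c) \<cdot>\<^bsub>Fo V\<^esub> d"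
          using v c T.m_comm[of c d] by (simp flip: FV.ract_mult)
        then show ?thesis
          using \<open>v \<cdot>\<^bsub>Fo V\<^esub> c = \<zero>\<^bsub>Fo V\<^esub>\<close> d(1) by (simp add: FV.zero_ract)
      qed
      then have "\<forall>y\<in>carrier (Fo K). y \<cdot>\<^bsub>Fo K\<^esub> c = \<zero>\<^bsub>Fo K\<^esub>"
        using kill[OF c] zeta_eq_zero_iff[OF V c] zeta_eq_zero_iff[OF K c] by blast
      then show ?thesis
        using x b c by (simp add: a_eq FK.ract_add_ring FK.ract_closed)
    qed
    define s where "s y = (SOME a. a \<in> carrier T \<and> v \<cdot>\<^bsub>Fo V\<^esub> a = y)" for y
    have s: "s y \<in> carrier T" "v \<cdot>\<^bsub>Fo V\<^esub> s y = y" if "y \<in> carrier (Fo V)" for y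
    proof -
      have "\<exists>a. a \<in> carrier T \<and> v \<cdot>\<^bsub>Fo V\<^esub> a = y"
        using that unfolding cyclic[symmetric] by auto
      from someI_ex[OF this] show "s y \<in> carrier T" "v \<cdot>\<^bsub>Fo V\<^esub> s y = y" by (simp_all add: s_def)
    qed
    define h where "h = (\<lambda>y\<in>carrier (Fo V). x \<cdot>\<^bsub>Fo K\<^esub> s y)"
    have "h \<in> mod_hom T (Fo V) (Fo K)"
      unfolding h_def
    proof (rule FV.restrict_in_mod_hom)
      fix y z assume y: "y \<in> carrier (Fo V)" and z: "z \<in> carrier (Fo V)"
      have "x \<cdot>\<^bsub>Fo K\<^esub> s (y \<oplus>\<^bsub>Fo V\<^esub> z) = x \<cdot>\<^bsub>Fo K\<^esub> (s y \<oplus>\<^bsub>T\<^esub> s z)"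
        using y z v s by (intro wd) (simp_all add: FV.ract_add_ring)
      then show "x \<cdot>\<^bsub>Fo K\<^esub> s (y \<oplus>\<^bsub>Fo V\<^esub> z) = x \<cdot>\<^bsub>Fo K\<^esub> s y \<oplus>\<^bsub>Fo K\<^esub> x \<cdot>\<^bsub>Fo K\<^esub> s z"
        using x y z s by (simp add: FK.ract_add_ring)
    next
      fix y a assume y: "y \<in> carrier (Fo V)" and a: "a \<in> carrier T"
      have "x \<cdot>\<^bsub>Fo K\<^esub> s (y \<cdot>\<^bsub>Fo V\<^esub> a) = x \<cdot>\<^bsub>Fo K\<^esub> (s y \<otimes>\<^bsub>T\<^esub> a)"
        using y a v s by (intro wd) (simp_all add: FV.ract_mult FV.ract_closed)
      then show "x \<cdot>\<^bsub>Fo K\<^esub> s (y \<cdot>\<^bsub>Fo V\<^esub> a) = x \<cdot>\<^bsub>Fo K\<^esub> s y \<cdot>\<^bsub>Fo K\<^esub> a"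
        using x y a s by (simp add: FK.ract_mult)
    qed (use x s in \<open>simp add: FK.ract_closed\<close>)
    then obtain f where f: "f \<in> mod_hom R V K" "Fm V K f = h"
      using full[OF V K] by blast
    \<comment> \<open>Homomorphic images of the simple module \<open>V\<close> lie in the socle,
      which is the kernel of \<open>q\<close>.\<close>
    have "q (f w) = \<zero>\<^bsub>Q\<^esub>" if "w \<in> carrier V" for w
      using K.simple_image_subset_socle[OF simple f(1)] ker that by blast
    then have "Fm K Q q (h v) = \<zero>\<^bsub>Fo Q\<^esub>"
      using mor_compose_eq_zero[OF V K Q f(1) q] v f(2) by blast
    moreover have "h v = x"
    proof -
      \<comment> \<open>The chosen scalar \<open>s v\<close> may differ from one; by
        \<open>wd\<close> both act alike on \<open>x\<close>.\<close>
      have "x \<cdot>\<^bsub>Fo K\<^esub> s v = x \<cdot>\<^bsub>Fo K\<^esub> \<one>\<^bsub>T\<^esub>"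
        using v s by (intro wd) (simp_all add: FV.ract_one)
      then show ?thesis using v x by (simp add: h_def FK.ract_one)
    qed
    ultimately show ?thesis by simp
  qed
  then have "\<forall>x\<in>carrier K. q x = \<zero>\<^bsub>Q\<^esub>"
    using mor_eq_zero_iff[OF K Q q] by blast
  then show ?thesis using ker by blast
qed

text \<open>With \<open>I\<close> the annihilator of \<open>V\<close>, the dual Baer property splits \<open>M\<close> as \<open>M I \<oplus> K\<close>. By naturality
  \<open>K I\<close> lies in \<open>K \<inter> M I = 0\<close>, so that \<open>K\<close> is semisimple.\<close>

lemma dual_baer_superset_socle:
  assumes db: "dual_baer R M" and simple: "simple_mod R V"
    and L: "submodule_of R L M" and soc: "socle R M \<subseteq> L"
    and ann: "\<And>t x. \<lbrakk>t \<in> carrier T; \<forall>v\<in>carrier V. zeta t V v = \<zero>\<^bsub>V\<^esub>; x \<in> carrier M\<rbrakk> \<Longrightarrow> zeta t M x \<in> L"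
  shows "L = carrier M"
proof -
  have M: "right_module R M" using db by (simp add: dual_baer_def)
  interpret M: right_module R M by fact
  \<comment> \<open>The images of these endomorphisms generate \<open>M I\<close>, where
    \<open>I\<close> is the annihilator of \<open>V\<close>.\<close>
  define E where "E = {zeta t M | t. t \<in> carrier T \<and> (\<forall>v\<in>carrier V. zeta t V v = \<zero>\<^bsub>V\<^esub>)}"
  have "E \<subseteq> mod_hom R M M" using zeta_hom[OF M] by (auto simp: E_def)
  then obtain e where e: "e \<in> mod_hom R M M" and idem: "\<And>x. x \<in> carrier M \<Longrightarrow> e (e x) = e x"
    and im: "e ` carrier M = gen_submodule R M (\<Union>f\<in>E. f ` carrier M)"
    by (rule M.dual_baer_projection[OF db]) blast
  note e' = mod_hom_closed[OF e]
  define K where "K = {x \<in> carrier M. e x = \<zero>\<^bsub>M\<^esub>}"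
  have K: "submodule_of R K M" unfolding K_def by (rule M.kernel_submodule[OF e M])
  have KM: "right_module R (M\<lparr>carrier := K\<rparr>)" by (rule M.submodule_is_module[OF K])
  interpret KM: right_module R "M\<lparr>carrier := K\<rparr>" by fact
  have incl: "(\<lambda>x\<in>K. x) \<in> mod_hom R (M\<lparr>carrier := K\<rparr>) M" by (rule M.inclusion_hom[OF K])
  have "socle R (M\<lparr>carrier := K\<rparr>) = carrier (M\<lparr>carrier := K\<rparr>)"
  proof (rule killed_by_annihilator_of_simple[OF simple KM], rule ballI)
    fix t x assume t: "t \<in> carrier T" "\<forall>v\<in>carrier V. zeta t V v = \<zero>\<^bsub>V\<^esub>"
      and x: "x \<in> carrier (M\<lparr>carrier := K\<rparr>)"
    then have xM: "x \<in> carrier M" and ex: "e x = \<zero>\<^bsub>M\<^esub>" by (auto simp: K_def)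
    have "zeta t M x \<in> (\<Union>f\<in>E. f ` carrier M)"
      using t xM by (auto simp: E_def)
    also have "\<dots> \<subseteq> e ` carrier M"
      unfolding im by (rule M.gen_submodule_superset)
    \<comment> \<open>\<open>zeta t M x\<close> lies in \<open>M I\<close>, where \<open>e\<close>
      is the identity; naturality then moves \<open>e\<close> inside, where it kills
      \<open>x\<close>.\<close>
    finally have "e (zeta t M x) = zeta t M x" using idem by auto
    then have "zeta t M x = zeta t M (e x)" using zeta_natural[OF M M t(1) e xM] by simp
    also have "\<dots> = \<zero>\<^bsub>M\<^esub>" unfolding ex by (rule M.hom_zero[OF zeta_hom[OF M t(1)] M])
    \<comment> \<open>Naturality along the inclusion of \<open>K\<close> identifies the endomorphism
      of \<open>K\<close> with the restriction of that of \<open>M\<close>.\<close>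
    finally show "zeta t (M\<lparr>carrier := K\<rparr>) x = \<zero>\<^bsub>M\<lparr>carrier := K\<rparr>\<^esub>"
      using zeta_natural[OF KM M t(1) incl x] x mod_hom_closed[OF zeta_hom[OF KM t(1)] x] by simp
  qed
  \<comment> \<open>The socle of \<open>K\<close> lies in that of \<open>M\<close>. The bound is
    written as a preimage under the inclusion, which makes it a submodule of \<open>K\<close> as
    \<open>socle_least\<close> demands.\<close>
  moreover have "socle R (M\<lparr>carrier := K\<rparr>) \<subseteq> {x \<in> carrier (M\<lparr>carrier := K\<rparr>). (\<lambda>x\<in>K. x) x \<in> socle R M}"
  proof (rule KM.socle_least[OF KM.preimage_submodule[OF incl M M.socle_submodule]])
    fix S assume S: "submodule_of R S (M\<lparr>carrier := K\<rparr>)"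
      and S_simple: "simple_mod R (M\<lparr>carrier := K, carrier := S\<rparr>)"
    have SK: "S \<subseteq> K" using KM.submodule_subset[OF S] by simp
    have "(\<lambda>x\<in>S. x) \<in> mod_hom R (M\<lparr>carrier := K, carrier := S\<rparr>) M"
      using right_module.mod_hom_enlarge_codomain[OF KM.submodule_is_module[OF S] KM.inclusion_hom[OF S]]
        M.submodule_subset[OF K] by simp
    from M.simple_image_subset_socle[OF S_simple this]
    show "S \<subseteq> {x \<in> carrier (M\<lparr>carrier := K\<rparr>). (\<lambda>x\<in>K. x) x \<in> socle R M}"
      using SK by auto
  qed
  ultimately have "K \<subseteq> L" using soc by auto
  have "gen_submodule R M (\<Union>f\<in>E. f ` carrier M) \<subseteq> L"
    by (rule M.gen_submodule_least[OF L]) (auto simp: E_def ann)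
  then have eL: "e x \<in> L" if "x \<in> carrier M" for x
    using im that by blast
  note L' = M.submodule_ofD[OF L]
  have "x \<in> L" if x: "x \<in> carrier M" for x
  proof -
    \<comment> \<open>Splits \<open>x\<close> into \<open>e x\<close> in \<open>M I\<close> and a
      remainder in \<open>K\<close>; both lie in \<open>L\<close>.\<close>
    have "e (x \<oplus>\<^bsub>M\<^esub> \<ominus>\<^bsub>M\<^esub> e x) = \<zero>\<^bsub>M\<^esub>"
      using x e' by (simp add: mod_hom_add[OF e] M.hom_neg[OF e M] idem M.M.r_neg)
    then have "x \<oplus>\<^bsub>M\<^esub> \<ominus>\<^bsub>M\<^esub> e x \<in> L"
      using x e' \<open>K \<subseteq> L\<close> by (auto simp: K_def)
    from L'(3)[OF this eL[OF x]] show ?thesis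
      using x e' by (simp add: M.M.a_assoc M.M.l_neg)
  qed
  then show ?thesis using L'(1) by blast
qed

section \<open>Semisimplicity in the finitely generated and the semi-Artinian case\<close>

lemma fin_gen_dual_baer_imp_semisimple:
  assumes db: "dual_baer R (M :: ('r, 'u) rmod)" and fg: "fin_gen R M"
  shows "socle R M = carrier M"
proof (rule ccontr)
  assume proper: "socle R M \<noteq> carrier M"
  have M: "right_module R M" using db by (simp add: dual_baer_def)
  interpret M: right_module R M by fact
  obtain L where L: "submodule_of R L M" "socle R M \<subseteq> L" "L \<noteq> carrier M"
    and max: "\<And>N. \<lbrakk>submodule_of R N M; L \<subseteq> N\<rbrakk> \<Longrightarrow> N = L \<or> N = carrier M"
    by (rule M.fin_gen_maximal_submodule[OF fg M.socle_submodule proper]) blast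
  obtain Q :: "('r, 'u) rmod" and q where Q: "right_module R Q" and q: "q \<in> mod_hom R M Q"
    and surj: "q ` carrier M = carrier Q" and ker: "{x \<in> carrier M. q x = \<zero>\<^bsub>Q\<^esub>} = L"
    by (rule M.quotient_exists[OF L(1) subset_imp_lepoll[OF subset_UNIV]])
  interpret Q: right_module R Q by fact
  have "P = {\<zero>\<^bsub>Q\<^esub>} \<or> P = carrier Q" if P: "submodule_of R P Q" for P
  proof -
    note P' = Q.submodule_ofD[OF P]
    \<comment> \<open>Submodules of \<open>M / L\<close> pull back to submodules between
      \<open>L\<close> and \<open>M\<close>, so maximality of \<open>L\<close> applies.\<close>
    have "L \<subseteq> {x \<in> carrier M. q x \<in> P}" using ker P'(2) by auto
    from max[OF M.preimage_submodule[OF q Q P] this]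
    show ?thesis
    proof
      assume "{x \<in> carrier M. q x \<in> P} = L"
      then have "P \<subseteq> {\<zero>\<^bsub>Q\<^esub>}" using ker surj P'(1) by (auto simp: image_iff set_eq_iff) metis
      then show ?thesis using P'(2) by blast
    next
      assume "{x \<in> carrier M. q x \<in> P} = carrier M"
      then have "q x \<in> P" if "x \<in> carrier M" for x using that by blast
      then have "carrier Q \<subseteq> P" unfolding surj[symmetric] by (rule image_subsetI)
      then show ?thesis using P'(1) by blast
    qed
  qed
  moreover have "carrier Q \<noteq> {\<zero>\<^bsub>Q\<^esub>}"
  proof
    assume "carrier Q = {\<zero>\<^bsub>Q\<^esub>}"
    then have "q x = \<zero>\<^bsub>Q\<^esub>" if "x \<in> carrier M" for x
      using mod_hom_closed[OF q that] by simp
    then have "carrier M \<subseteq> L" unfolding ker[symmetric] by auto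
    with M.submodule_subset[OF L(1)] have "L = carrier M" by (rule equalityI)
    with L(3) show False by contradiction
  qed
  ultimately have simple: "simple_mod R Q" using Q by (simp add: simple_mod_def)
  have "L = carrier M"
  proof (rule dual_baer_superset_socle[OF db simple L(1,2)])
    fix t x assume t: "t \<in> carrier T" "\<forall>v\<in>carrier Q. zeta t Q v = \<zero>\<^bsub>Q\<^esub>" and x: "x \<in> carrier M"
    \<comment> \<open>By naturality of the projection, an element acting as zero on
      \<open>M / L\<close> sends \<open>M\<close> into \<open>L\<close>.\<close>
    then have "q (zeta t M x) = \<zero>\<^bsub>Q\<^esub>"
      using zeta_natural[OF M Q t(1) q x] mod_hom_closed[OF q x] by simp
    then show "zeta t M x \<in> L"
      using ker mod_hom_closed[OF zeta_hom[OF M t(1)] x] by blast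
  qed
  then show False using L(3) by simp
qed

text \<open>The simple module comes from the socle of \<open>T / A\<close>, where \<open>A\<close> is the annihilator of \<open>B\<close>.\<close>

lemma semi_artinian_annihilator:
  assumes sa: "semi_artinian TYPE('u) R" and card: "carrier T \<lesssim> (UNIV :: 'u set)"
    and B: "right_module R B" and nonzero: "carrier B \<noteq> {\<zero>\<^bsub>B\<^esub>}"
  obtains V :: "('r, 'u) rmod" and s where "simple_mod R V" "s \<in> carrier T"
    "\<exists>x\<in>carrier B. zeta s B x \<noteq> \<zero>\<^bsub>B\<^esub>"
    "\<And>t. \<lbrakk>t \<in> carrier T; \<forall>v\<in>carrier V. zeta t V v = \<zero>\<^bsub>V\<^esub>\<rbrakk>
       \<Longrightarrow> \<forall>x\<in>carrier B. zeta (s \<otimes>\<^bsub>T\<^esub> t) B x = \<zero>\<^bsub>B\<^esub>"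
proof -
  interpret T: cring T by (rule T_cring)
  interpret B: right_module R B by fact
  interpret FB: right_module T "Fo B" by (rule obj[OF B])
  \<comment> \<open>\<open>T\<close> as a right module over itself, with elements of type
    \<open>'t\<close>. The hypothesis \<open>card\<close> moves its quotient by \<open>A\<close> to
    the type \<open>'u\<close>, where the equivalence applies.\<close>
  define reg :: "('t, 't) rmod" where
    "reg = \<lparr>carrier = carrier T, mult = mult T, one = \<one>\<^bsub>T\<^esub>, zero = \<zero>\<^bsub>T\<^esub>, add = add T, ract = mult T\<rparr>"
  have "abelian_group reg"
    by (rule abelian_groupI) (auto simp: reg_def T.a_ac intro: T.l_neg bexI[of _ "\<ominus>\<^bsub>T\<^esub> _"])
  then have reg: "right_module T reg"
    by (intro right_module.intro right_module_axioms.intro T.ring_axioms)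
       (auto simp: reg_def T.l_distr T.r_distr T.m_assoc)
  interpret reg: right_module T reg by fact
  define A where "A = {a \<in> carrier T. \<forall>y\<in>carrier (Fo B). y \<cdot>\<^bsub>Fo B\<^esub> a = \<zero>\<^bsub>Fo B\<^esub>}"
  have A: "submodule_of T A reg"
    by (rule reg.submodule_ofI)
       (auto simp: reg_def A_def FB.ract_zero FB.ract_add_ring FB.ract_mult FB.zero_ract)
  have A_iff: "(\<forall>x\<in>carrier B. zeta a B x = \<zero>\<^bsub>B\<^esub>) \<longleftrightarrow> a \<in> A" if "a \<in> carrier T" for a
    using zeta_eq_zero_iff[OF B that] that by (simp add: A_def)
  have "carrier reg \<lesssim> (UNIV :: 'u set)" using card by (simp add: reg_def)
  then obtain W :: "('t, 'u) rmod" and q where W: "right_module T W" and q: "q \<in> mod_hom T reg W"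
    and surj: "q ` carrier reg = carrier W" and ker: "{x \<in> carrier reg. q x = \<zero>\<^bsub>W\<^esub>} = A"
    by (rule reg.quotient_exists[OF A])
  interpret W: right_module T W by fact
  \<comment> \<open>The semi-Artinian property concerns \<open>R\<close>, so \<open>T / A\<close> is
    replaced by the \<open>R\<close>-module \<open>C\<close> corresponding to it.\<close>
  obtain C i j where C: "right_module R C" and i: "i \<in> mod_hom T (Fo C) W" and j: "j \<in> mod_hom T W (Fo C)"
    and ji: "\<And>x. x \<in> carrier (Fo C) \<Longrightarrow> j (i x) = x" and ij: "\<And>y. y \<in> carrier W \<Longrightarrow> i (j y) = y"
    using dense[OF W] by auto
  interpret C: right_module R C by fact
  interpret FC: right_module T "Fo C" by (rule obj[OF C])
  have i0: "i \<zero>\<^bsub>Fo C\<^esub> = \<zero>\<^bsub>W\<^esub>" by (rule FC.hom_zero[OF i W])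
  have j0: "j \<zero>\<^bsub>W\<^esub> = \<zero>\<^bsub>Fo C\<^esub>" by (rule W.hom_zero[OF j obj[OF C]])
  have "\<one>\<^bsub>T\<^esub> \<notin> A"
  proof
    assume "\<one>\<^bsub>T\<^esub> \<in> A"
    \<comment> \<open>The identity of \<open>Fo B\<close> would be zero, and with it the identity of
      \<open>B\<close>.\<close>
    then have "\<forall>y\<in>carrier (Fo B). y = \<zero>\<^bsub>Fo B\<^esub>" by (simp add: A_def FB.ract_one)
    then have "\<forall>x\<in>carrier B. x = \<zero>\<^bsub>B\<^esub>"
      using mor_eq_zero_iff[OF B B B.ident_hom] by (simp add: ident[OF B])
    then show False using nonzero B.M.zero_closed by blast
  qed
  moreover have one: "\<one>\<^bsub>T\<^esub> \<in> carrier reg" by (simp add: reg_def)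
  ultimately have q1: "q \<one>\<^bsub>T\<^esub> \<in> carrier W" "q \<one>\<^bsub>T\<^esub> \<noteq> \<zero>\<^bsub>W\<^esub>"
    using ker mod_hom_closed[OF q one] by auto
  have "carrier C \<noteq> {\<zero>\<^bsub>C\<^esub>}"
  proof
    assume "carrier C = {\<zero>\<^bsub>C\<^esub>}"
    then have "\<forall>x\<in>carrier C. (\<lambda>x\<in>carrier C. x) x = \<zero>\<^bsub>C\<^esub>"
      by auto
    then have "\<forall>y\<in>carrier (Fo C). y = \<zero>\<^bsub>Fo C\<^esub>"
      using mor_eq_zero_iff[OF C C C.ident_hom] by (simp add: ident[OF C])
    then show False
      using q1 ij[OF q1(1)] i0 mod_hom_closed[OF j q1(1)] by simp
  qed
  then have "socle R C \<noteq> {\<zero>\<^bsub>C\<^esub>}"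
    using sa C by (simp add: semi_artinian_def)
  then obtain S where S: "submodule_of R S C" and simple: "simple_mod R (C\<lparr>carrier := S\<rparr>)"
    using C.socle_least[OF C.zero_submodule] C.submodule_ofD(2)[OF C.socle_submodule] by blast
  let ?S = "C\<lparr>carrier := S\<rparr>"
  have SC: "right_module R ?S" by (rule C.submodule_is_module[OF S])
  interpret FS: right_module T "Fo ?S" by (rule obj[OF SC])
  have incl: "(\<lambda>x\<in>S. x) \<in> mod_hom R ?S C" by (rule C.inclusion_hom[OF S])
  have "\<exists>x\<in>carrier ?S. (\<lambda>x\<in>S. x) x \<noteq> \<zero>\<^bsub>C\<^esub>"
    using simple C.submodule_ofD(2)[OF S] by (auto simp: simple_mod_def)
  \<comment> \<open>The inclusion of \<open>S\<close> into \<open>C\<close> is nonzero, so its image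
    under the functor is nonzero at some \<open>v\<close>; this yields a nonzero element
    \<open>h v\<close> of \<open>T / A\<close>.\<close>
  then obtain v where v: "v \<in> carrier (Fo ?S)" "Fm ?S C (\<lambda>x\<in>S. x) v \<noteq> \<zero>\<^bsub>Fo C\<^esub>"
    using mor_eq_zero_iff[OF SC C incl] by blast
  define h where "h = compose (carrier (Fo ?S)) i (Fm ?S C (\<lambda>x\<in>S. x))"
  have h: "h \<in> mod_hom T (Fo ?S) W"
    unfolding h_def by (rule FS.compose_hom[OF mor[OF SC C incl] i])
  have hv: "h v \<in> carrier W" "h v \<noteq> \<zero>\<^bsub>W\<^esub>"
    using mod_hom_closed[OF h v(1)] v ji[OF mod_hom_closed[OF mor[OF SC C incl] v(1)]] j0
    by (auto simp: h_def compose_eq)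
  \<comment> \<open>A representative in \<open>T\<close> of the nonzero class
    \<open>h v\<close>.\<close>
  then obtain s where s: "s \<in> carrier T" "h v = q s"
    using surj by (auto simp: reg_def)
  then have "s \<notin> A" using hv ker by auto
  show ?thesis
  proof (rule that[OF simple s(1)])
    show "\<exists>x\<in>carrier B. zeta s B x \<noteq> \<zero>\<^bsub>B\<^esub>"
      using A_iff[OF s(1)] \<open>s \<notin> A\<close> by blast
  next
    fix t assume t: "t \<in> carrier T" "\<forall>v\<in>carrier ?S. zeta t ?S v = \<zero>\<^bsub>?S\<^esub>"
    then have "v \<cdot>\<^bsub>Fo ?S\<^esub> t = \<zero>\<^bsub>Fo ?S\<^esub>"
      using zeta_eq_zero_iff[OF SC t(1)] v(1) by blast
    \<comment> \<open>An element \<open>t\<close> acting as zero on the simple module also kills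
      \<open>h v\<close>, the class of \<open>s\<close>; so \<open>s t\<close> represents zero in
      \<open>T / A\<close>.\<close>
    then have "h v \<cdot>\<^bsub>W\<^esub> t = \<zero>\<^bsub>W\<^esub>"
      using mod_hom_act[OF h v(1) t(1)] FS.hom_zero[OF h W] by simp
    then have "q (s \<otimes>\<^bsub>T\<^esub> t) = \<zero>\<^bsub>W\<^esub>"
      using mod_hom_act[OF q, of s t] s t(1) by (simp add: reg_def)
    then have "s \<otimes>\<^bsub>T\<^esub> t \<in> A"
      using ker s(1) t(1) by (auto simp: reg_def)
    then show "\<forall>x\<in>carrier B. zeta (s \<otimes>\<^bsub>T\<^esub> t) B x = \<zero>\<^bsub>B\<^esub>"
      using A_iff s(1) t(1) by simp
  qed
qed

lemma semi_artinian_dual_baer_imp_semisimple: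
  assumes sa: "semi_artinian TYPE('u) R" and card: "carrier T \<lesssim> (UNIV :: 'u set)"
    and db: "dual_baer R (M :: ('r, 'u) rmod)"
  shows "socle R M = carrier M"
proof (rule ccontr)
  assume proper: "socle R M \<noteq> carrier M"
  have M: "right_module R M" using db by (simp add: dual_baer_def)
  interpret M: right_module R M by fact
  obtain Q :: "('r, 'u) rmod" and q where Q: "right_module R Q" and q: "q \<in> mod_hom R M Q"
    and surj: "q ` carrier M = carrier Q" and ker: "{x \<in> carrier M. q x = \<zero>\<^bsub>Q\<^esub>} = socle R M"
    by (rule M.quotient_exists[OF M.socle_submodule subset_imp_lepoll[OF subset_UNIV]])
  interpret Q: right_module R Q by fact
  have "carrier Q \<noteq> {\<zero>\<^bsub>Q\<^esub>}"
    using proper ker surj by auto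
  then obtain V :: "('r, 'u) rmod" and s where simple: "simple_mod R V" and s: "s \<in> carrier T"
    and nonzero: "\<exists>x\<in>carrier Q. zeta s Q x \<noteq> \<zero>\<^bsub>Q\<^esub>"
    and ann: "\<And>t. \<lbrakk>t \<in> carrier T; \<forall>v\<in>carrier V. zeta t V v = \<zero>\<^bsub>V\<^esub>\<rbrakk>
       \<Longrightarrow> \<forall>x\<in>carrier Q. zeta (s \<otimes>\<^bsub>T\<^esub> t) Q x = \<zero>\<^bsub>Q\<^esub>"
    using semi_artinian_annihilator[OF sa card Q] by blast
  \<comment> \<open>The action of \<open>s\<close> on \<open>M / soc M\<close>, pulled back to
    \<open>M\<close>. Its kernel contains the socle and also \<open>M I\<close>, since
    \<open>s t\<close> annihilates the quotient for every \<open>t\<close> in the annihilator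
    \<open>I\<close> of \<open>V\<close>; so the kernel is all of \<open>M\<close>, against the
    choice of \<open>s\<close>.\<close>
  define f where "f = compose (carrier M) (zeta s Q) q"
  have f: "f \<in> mod_hom R M Q"
    unfolding f_def by (rule M.compose_hom[OF q zeta_hom[OF Q s]])
  define L where "L = {x \<in> carrier M. f x = \<zero>\<^bsub>Q\<^esub>}"
  have L: "submodule_of R L M" unfolding L_def by (rule M.kernel_submodule[OF f Q])
  have "socle R M \<subseteq> L"
    unfolding ker[symmetric] L_def
    using Q.hom_zero[OF zeta_hom[OF Q s] Q] by (auto simp: f_def compose_eq)
  then have "L = carrier M"
  proof (rule dual_baer_superset_socle[OF db simple L])
    fix t x assume t: "t \<in> carrier T" "\<forall>v\<in>carrier V. zeta t V v = \<zero>\<^bsub>V\<^esub>" and x: "x \<in> carrier M"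
    have "f (zeta t M x) = zeta (s \<otimes>\<^bsub>T\<^esub> t) Q (q x)"
      using mod_hom_closed[OF zeta_hom[OF M t(1)] x] mod_hom_closed[OF q x] s t(1)
      by (simp add: f_def compose_eq zeta_natural[OF M Q t(1) q x] zeta_mult[OF Q])
    also have "\<dots> = \<zero>\<^bsub>Q\<^esub>" using ann[OF t] mod_hom_closed[OF q x] by blast
    finally show "zeta t M x \<in> L"
      using mod_hom_closed[OF zeta_hom[OF M t(1)] x] by (simp add: L_def)
  qed
  then have "f x = \<zero>\<^bsub>Q\<^esub>" if "x \<in> carrier M" for x
    using that unfolding L_def by blast
  then have "zeta s Q (q x) = \<zero>\<^bsub>Q\<^esub>" if "x \<in> carrier M" for x
    using that by (simp add: f_def compose_eq)
  then show False using nonzero surj by (metis imageE)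
qed

end

theorem theorem3p4:
  fixes R :: "('r, 'x) ring_scheme" and T :: "('t, 'y) ring_scheme"
  assumes "ring R" and "cring T"
    and "infinite (UNIV :: 'u set)"
    and "carrier R \<lesssim> (UNIV :: 'u set)"
    and "carrier T \<lesssim> (UNIV :: 'u set)"
    and "morita_equivalent TYPE('u) R T"
  shows "(\<forall>M :: ('r, 'u) rmod. right_module R M \<and> fin_gen R M \<longrightarrow>
            (dual_baer R M \<longleftrightarrow> semisimple_mod R M)) \<and>
         (semi_artinian TYPE('u) R \<longrightarrow>
            (\<forall>M :: ('r, 'u) rmod. right_module R M \<longrightarrow>
               (dual_baer R M \<longleftrightarrow> semisimple_mod R M)))"
proof -
  obtain Fo and Fm :: "('r, 'u) rmod \<Rightarrow> _" where "module_equivalence R T Fo Fm"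
    by (rule morita_equivalent_module_equivalence[OF assms(2,6)])
  then interpret module_equivalence R T Fo Fm .
  \<comment> \<open>Semisimple modules are dual Baer over any ring; the equivalence with
    \<open>T\<close> serves the two converse implications.\<close>
  show ?thesis
    unfolding semisimple_mod_def
    using fin_gen_dual_baer_imp_semisimple semi_artinian_dual_baer_imp_semisimple[OF _ assms(5)]
      right_module.semisimple_imp_dual_baer by blast
qed

end
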